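(* Let $N\ge 3$ be an integer, $p>1$, and let $(\mathcal X(t))_{t\ge0}$ be the $p$-contest process with $N$ points and replacement distribution $\zeta$ having full support on $[0,1]$. (a) $\mathbb P\left(\{\mathcal X'(t)\to 0\}\cup\{\mathcal X'(t)\to 1\}\right)=1$. (b) If $x_{(1)}(0)\ge 1/p$, then $\mathbb P(\mathcal X'(t)\to 1)=1$. (c) If $x_{(k)}(0)>0$ for some $k\in\{1,\dots,N-1\}$ satisfying $2p(N-k)>N-2p$ (equivalently $k<N-\frac{N}{2p}+1$), then $\mathbb P(\mathcal X'(t)\to 1)>0$.
   Context: Unordered tuples are understood with repetitions (multisets). For $\mathcal X=\{x_1,\dots,x_N\}$ let $\mu_N=\frac1N\sum_{i=1}^N x_i$; the $p$-centre of mass is $p\mu_N$. The extreme point of $\mathcal X$ is the point of $\mathcal X$ farthest from $p\mu_N$ (it is the smallest or the largest point; in case of a tie between the left-most and the right-most point, either one is chosen with probability $1/2$). The core $\mathcal X'$ is the $(N-1)$-tuple obtained from $\mathcal X$ by removing (one copy of) the extreme point. The random variable $\zeta$ takes values in $[0,1]$ and has full support: $\mathbb P(\zeta\in(a,b))>0$ whenever $0\le a<b\le 1$. The $p$-contest process: given $\mathcal X(t)$, set $\mathcal X(t+1)=\mathcal X'(t)\cup\{\zeta_{t+1}\}$, where $\zeta_1,\zeta_2,\dots$ are i.i.d. with the distribution of $\zeta$, independent of $\mathcal X(0)$; the initial configuration $\mathcal X(0)$ is an arbitrary (possibly random) configuration of points of $[0,1]$. The notation $x_{(1)}(t)\le\dots\le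 x_{(N-1)}(t)$ denotes the points of the core $\mathcal X'(t)$ in non-decreasing order. $\mathcal X'(t)\to a$ means $x_{(i)}(t)\to a$ as $t\to\infty$ for all $i=1,\dots,N-1$. Hypotheses on $x_{(i)}(0)$ are assumed to hold almost surely. *)

theory Defs
  imports "HOL-Probability.Probability" "HOL-Library.Multiset"
begin

definition centre_of_mass :: "real \<Rightarrow> real multiset \<Rightarrow> real" where
  "centre_of_mass p S = p * (sum_mset S / real (size S))"

definition farthest_points :: "real \<Rightarrow> real multiset \<Rightarrow> real set" where
  "farthest_points p S =
     {x \<in> set_mset S. \<forall>y \<in> set_mset S.
        dist y (centre_of_mass p S) \<le> dist x (centre_of_mass p S)}"

text \<open>
  At most two distinct points of a configuration are at maximal distance from the centre, and if
  there are two they are the left-most and the right-most point. The Boolean argument is the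
  outcome of the coin that resolves such a tie; without a tie it has no effect.
\<close>

definition extreme_point :: "real \<Rightarrow> bool \<Rightarrow> real multiset \<Rightarrow> real" where
  "extreme_point p right S =
     (if right then Max (farthest_points p S) else Min (farthest_points p S))"

definition core :: "real \<Rightarrow> bool \<Rightarrow> real multiset \<Rightarrow> real multiset" where
  "core p right S = S - {#extreme_point p right S#}"

text \<open>Order statistics are numbered from 1.\<close>

definition order_stat :: "nat \<Rightarrow> real multiset \<Rightarrow> real" where
  "order_stat k S = sorted_list_of_multiset S ! (k - 1)"

text \<open>
  Unordered tuples of \<open>N\<close> reals, with the \<open>\<sigma>\<close>-algebra generated by the order statistics.
\<close>

definition configurations :: "nat \<Rightarrow> real multiset measure" where
  "configurations N =
     vimage_algebra {S. size S = N} (\<lambda>S. \<lambda>i\<in>{1..N}. order_stat i S) (Pi\<^sub>M {1..N} (\<lambda>_. borel))"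

text \<open>
  The sources of randomness: the initial configuration, the replacement points
  \<open>\<zeta>\<^sub>1, \<zeta>\<^sub>2, \<dots>\<close>, and one fair coin for each time \<open>t \<ge> 0\<close>, used only to break a tie at
  time \<open>t\<close>. They are jointly independent. Since they have different types, independence is
  expressed through the generated \<open>\<sigma>\<close>-algebras.
\<close>

datatype randomness = Initial | Replacement nat | Coin nat

locale p_contest = prob_space M
  for M :: "'a measure" +
  fixes N :: nat
    and p :: real
    and D :: "real measure"
    and X :: "nat \<Rightarrow> 'a \<Rightarrow> real multiset"
    and \<zeta> :: "nat \<Rightarrow> 'a \<Rightarrow> real"
    and B :: "nat \<Rightarrow> 'a \<Rightarrow> bool"
  assumes initial_measurable: "X 0 \<in> measurable M (configurations N)"
    and initial_unit: "AE \<omega> in M. set_mset (X 0 \<omega>) \<subseteq> {0..1}"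
    and replacement_measurable: "\<And>t. t \<ge> 1 \<Longrightarrow> random_variable borel (\<zeta> t)"
    and replacement_distr: "\<And>t. t \<ge> 1 \<Longrightarrow> distr M borel (\<zeta> t) = D"
    and replacement_unit: "AE x in D. x \<in> {0..1}"
    and full_support: "\<And>a b. 0 \<le> a \<Longrightarrow> a < b \<Longrightarrow> b \<le> 1 \<Longrightarrow> measure D {a<..<b} > 0"
    and coin_measurable: "\<And>t. random_variable (count_space UNIV) (B t)"
    and coin_fair: "\<And>t. prob {\<omega> \<in> space M. B t \<omega>} = 1 / 2"
    and independent:
      "indep_sets
         (\<lambda>s. case s of
            Initial \<Rightarrow> sets (vimage_algebra (space M) (X 0) (configurations N))
          | Replacement t \<Rightarrow> sets (vimage_algebra (space M) (\<zeta> t) borel)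
          | Coin t \<Rightarrow> sets (vimage_algebra (space M) (B t) (count_space UNIV)))
         ({Initial} \<union> Replacement ` {1..} \<union> range Coin)"
    and step: "\<And>t \<omega>. \<omega> \<in> space M \<Longrightarrow>
      X (Suc t) \<omega> = add_mset (\<zeta> (Suc t) \<omega>) (core p (B t \<omega>) (X t \<omega>))"

definition core_tendsto ::
    "nat \<Rightarrow> real \<Rightarrow> (nat \<Rightarrow> 'a \<Rightarrow> real multiset) \<Rightarrow> (nat \<Rightarrow> 'a \<Rightarrow> bool) \<Rightarrow> real \<Rightarrow> 'a \<Rightarrow> bool" where
  "core_tendsto N p X B a \<omega> \<longleftrightarrow>
     (\<forall>i\<in>{1..N - 1}. (\<lambda>t. order_stat i (core p (B t \<omega>) (X t \<omega>))) \<longlonglongrightarrow> a)"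

end

theory Submission
  imports Defs
begin

text \<open>
  Let \<open>Y t\<close> be the core at time \<open>t\<close>. The next core arises by adding a point \<open>z\<close> and then removing
  the smallest or the largest of the \<open>N\<close> points: the smallest if \<open>2 * p * sum / N\<close> exceeds
  \<open>min + max\<close>, the largest if it falls short, either one if they agree. Three deterministic consequences carry the proof.

  (1) Above \<open>1 / p\<close> the process only rises. If the whole core lies in \<open>[1/p, 1]\<close>, the smallest
  point is always the one removed (\<open>core_above_drops_lowest\<close>). Every order statistic is then
  nondecreasing, and each new point above a level displaces a point below that level as long as
  there is one, so the core tends to \<open>1\<close> if \<open>z\<close> comes arbitrarily close to \<open>1\<close> infinitely often.

  (2) Escape. Suppose that \<open>N - k\<close> core points are at least \<open>e > 0\<close> and \<open>N < 2 * p * (N - k + 1)\<close>.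
  If all new points fall slightly above \<open>e\<close>, then as long as points below \<open>e\<close> remain, every removal
  hits the smallest point or a point above the new ones: when no points lie above the new ones,
  the smallest point goes, because \<open>N - k + 1\<close> points near \<open>e\<close> outweigh \<open>k - 1\<close> points at \<open>0\<close>
  precisely under this inequality. After boundedly many steps all points are at least \<open>e\<close>. Repeating
  this along the levels \<open>e, r e, r^2 e, \<dots>\<close> with a suitable \<open>r > 1\<close> drives the core above \<open>1 / p\<close>
  (\<open>steers_escape\<close>). Only finitely many intervals, determined by \<open>e\<close>, occur for the new points,
  hence the probability of such a run is bounded below in terms of \<open>e\<close>.

  (3) Collapse. Let \<open>K < N\<close> be the largest rank allowed in (2). Then
  \<open>2 * p * (N - K - 1) < N\<close>, which says that \<open>N - K - 1\<close> large points among points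
  that are nearly \<open>0\<close> cannot keep the largest point from being removed. Hence, if the \<open>K\<close>-th order
  statistic of the core tends to \<open>0\<close>, so does the whole core, provided that \<open>z\<close> is close to \<open>0\<close>
  infinitely often (\<open>collapse_step\<close>, \<open>collapses\<close>).

  Convergence is now a dichotomy. Either the \<open>K\<close>-th order statistic tends to \<open>0\<close>, and (3) applies, or
  for some \<open>e\<close> it is at least \<open>e\<close> infinitely often. In the second case a conditional
  Borel-Cantelli argument (\<open>AE_infinitely_often_hit\<close>) shows that almost surely one of these visits
  is followed by a successful run as in (2), and (1) gives the limit \<open>1\<close>. A core that starts above
  \<open>1 / p\<close> is covered by (1) alone. If the \<open>k\<close>-th order statistic is initially positive for an
  admissible \<open>k\<close>, it exceeds some fixed \<open>e\<close> with positive probability, and (2) and (1) give the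
  limit \<open>1\<close> with positive probability.
\<close>

section \<open>Counting the points above a level\<close>

text \<open>
  Adding or removing a point changes this count by at most one, whereas it shifts the numbering of
  the order statistics. Both the dynamics and the measurability arguments are therefore carried out
  with these counts; \<open>le_order_stat_iff\<close> translates back.
\<close>

definition tail_count :: "real \<Rightarrow> real multiset \<Rightarrow> nat" where
  "tail_count a S = size {#x \<in># S. a \<le> x#}"

lemma tail_count_add_mset [simp]:
  "tail_count a (add_mset z S) = tail_count a S + of_bool (a \<le> z)"
  by (simp add: tail_count_def)

lemma tail_count_remove:
  assumes "e \<in># S"
  shows "tail_count a (S - {#e#}) + of_bool (a \<le> e) = tail_count a S"
  using assms by (metis insert_DiffM tail_count_add_mset)

lemma tail_count_le_size: "tail_count a S \<le> size S"
  by (simp add: tail_count_def size_filter_mset_lesseq)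

lemma tail_count_eq_size_iff: "tail_count a S = size S \<longleftrightarrow> (\<forall>x\<in>#S. a \<le> x)"
proof (induction S)
  case (add x S)
  then show ?case using tail_count_le_size[of a S] by (auto split: if_splits)
qed (simp add: tail_count_def)

lemma tail_count_eq_0_iff: "tail_count a S = 0 \<longleftrightarrow> (\<forall>x\<in>#S. x < a)"
  by (induction S) (auto simp: tail_count_def)

lemma tail_count_antimono: "a \<le> b \<Longrightarrow> tail_count b S \<le> tail_count a S"
  by (induction S) (auto simp: tail_count_def)

lemma mset_order_stats:
  "S = image_mset (\<lambda>i. order_stat i S) (mset_set {1..size S})"
proof -
  let ?xs = "sorted_list_of_multiset S"
  have len: "length ?xs = size S" by (metis mset_sorted_list_of_multiset size_mset)
  have "S = mset (map (\<lambda>i. ?xs ! i) [0..<length ?xs])"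
    by (simp only: map_nth mset_sorted_list_of_multiset)
  also have "\<dots> = image_mset (\<lambda>i. ?xs ! i) (mset_set {0..<size S})"
    by (simp only: mset_map mset_upt len)
  also have "{0..<size S} = (\<lambda>i. i - 1) ` {1..size S}"
    by (force simp: image_iff intro: bexI[of _ "Suc x" for x])
  also have "mset_set \<dots> = image_mset (\<lambda>i. i - 1) (mset_set {1..size S})"
    by (subst image_mset_mset_set) (auto simp: inj_on_def)
  finally show ?thesis by (simp only: order_stat_def image_mset.compositionality o_def)
qed

lemma tail_count_order_stats:
  "tail_count a S = card {i \<in> {1..size S}. a \<le> order_stat i S}"
proof -
  have "tail_count a S =
      size {#x \<in># image_mset (\<lambda>i. order_stat i S) (mset_set {1..size S}). a \<le> x#}"
    unfolding tail_count_def by (subst mset_order_stats) simp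
  then show ?thesis by (simp add: filter_mset_image_mset filter_mset_mset_set)
qed

lemma sum_mset_order_stats: "sum_mset S = (\<Sum>i\<in>{1..size S}. order_stat i S)"
proof -
  have "sum_mset S = sum_mset (image_mset (\<lambda>i. order_stat i S) (mset_set {1..size S}))"
    using mset_order_stats[of S] by simp
  then show ?thesis by (simp add: sum_unfold_sum_mset)
qed

lemma order_stat_mono:
  assumes "i \<le> j" "1 \<le> i" "j \<le> size S"
  shows "order_stat i S \<le> order_stat j S"
proof -
  have len: "length (sorted_list_of_multiset S) = size S"
    by (metis mset_sorted_list_of_multiset size_mset)
  show ?thesis
    unfolding order_stat_def
    by (rule sorted_nth_mono) (use assms len sorted_sorted_list_of_multiset[of S] in auto)
qed

lemma le_order_stat_iff:
  assumes "k \<in> {1..size S}"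
  shows "a \<le> order_stat k S \<longleftrightarrow> size S < tail_count a S + k"
proof
  let ?I = "{i \<in> {1..size S}. a \<le> order_stat i S}"
  assume a: "a \<le> order_stat k S"
  have "{k..size S} \<subseteq> ?I"
    using assms a by (auto intro: order_trans[OF _ order_stat_mono])
  then have "card {k..size S} \<le> card ?I" by (intro card_mono) auto
  then show "size S < tail_count a S + k"
    using assms by (simp add: tail_count_order_stats)
next
  let ?I = "{i \<in> {1..size S}. a \<le> order_stat i S}"
  assume less: "size S < tail_count a S + k"
  show "a \<le> order_stat k S"
  proof (rule ccontr)
    assume n: "\<not> a \<le> order_stat k S"
    have "?I \<subseteq> {Suc k..size S}"
    proof
      fix i assume i: "i \<in> ?I"
      then have "\<not> i \<le> k" using n assms order_stat_mono[of i k S] by force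
      then show "i \<in> {Suc k..size S}" using i by auto
    qed
    then have "card ?I \<le> card {Suc k..size S}" by (intro card_mono) auto
    then have "tail_count a S \<le> size S - k" by (simp add: tail_count_order_stats)
    moreover have "k \<le> size S" using assms by simp
    ultimately show False using less by linarith
  qed
qed

lemma set_mset_order_stats: "set_mset S = (\<lambda>i. order_stat i S) ` {1..size S}"
  by (subst mset_order_stats) simp

lemma order_stat_in_set: "k \<in> {1..size S} \<Longrightarrow> order_stat k S \<in># S"
  by (simp add: set_mset_order_stats)

lemma Min_mset_order_stat: "S \<noteq> {#} \<Longrightarrow> Min (set_mset S) = order_stat 1 S"
  by (intro Min_eqI order_stat_in_set)
    (auto simp: set_mset_order_stats Suc_le_eq nonempty_has_size intro!: order_stat_mono)

lemma Max_mset_order_stat: "S \<noteq> {#} \<Longrightarrow> Max (set_mset S) = order_stat (size S) S"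
  by (intro Max_eqI order_stat_in_set)
    (auto simp: set_mset_order_stats Suc_le_eq nonempty_has_size intro!: order_stat_mono)

section \<open>Measurability\<close>

lemma measurable_order_stat:
  assumes "Z \<in> measurable G (configurations n)" "i \<in> {1..n}"
  shows "(\<lambda>w. order_stat i (Z w)) \<in> borel_measurable G"
proof -
  have "(\<lambda>S. \<lambda>i\<in>{1..n}. order_stat i S) \<in> measurable (configurations n) (Pi\<^sub>M {1..n} (\<lambda>_. borel))"
    unfolding configurations_def by (intro measurable_vimage_algebra1) (auto simp: space_PiM)
  from measurable_compose[OF this measurable_component_singleton[OF assms(2)]] assms(2)
  have "order_stat i \<in> borel_measurable (configurations n)" by simp
  with assms(1) show ?thesis by simp
qed

lemma measurable_configuration_size:
  assumes "Z \<in> measurable G (configurations n)" "w \<in> space G"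
  shows "size (Z w) = n"
  using measurable_space[OF assms] by (simp add: configurations_def)

lemma measurable_tail_count:
  assumes "Z \<in> measurable G (configurations n)"
  shows "(\<lambda>w. tail_count a (Z w)) \<in> measurable G (count_space UNIV)"
proof -
  note [measurable] = measurable_order_stat[OF assms]
  have "(\<lambda>w. \<Sum>i\<in>{1..n}. of_bool (a \<le> order_stat i (Z w)) :: nat) \<in> measurable G (count_space UNIV)"
    by measurable
  moreover have "tail_count a (Z w) = (\<Sum>i\<in>{1..n}. of_bool (a \<le> order_stat i (Z w)))"
    if "w \<in> space G" for w
    using measurable_configuration_size[OF assms that]
    by (auto simp: tail_count_order_stats intro!: arg_cong[of _ _ card])
  ultimately show ?thesis by (simp cong: measurable_cong)
qed

text \<open>
  The events \<open>a \<le> order_stat i S\<close>, which generate the \<open>\<sigma>\<close>-algebra, are events about counts.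
\<close>

lemma measurable_configurationsI:
  assumes size: "\<And>w. w \<in> space G \<Longrightarrow> size (Z w) = n"
    and cnt: "\<And>a. (\<lambda>w. tail_count a (Z w)) \<in> measurable G (count_space UNIV)"
  shows "Z \<in> measurable G (configurations n)"
  unfolding configurations_def
proof (rule measurable_vimage_algebra2)
  show "Z \<in> space G \<rightarrow> {S. size S = n}" using size by auto
  have "(\<lambda>w. order_stat i (Z w)) \<in> borel_measurable G" if "i \<in> {1..n}" for i
  proof (rule borel_measurable_iff_ge[THEN iffD2], intro allI)
    fix a
    note [measurable] = cnt[of a]
    have "{w \<in> space G. a \<le> order_stat i (Z w)} = {w \<in> space G. n < tail_count a (Z w) + i}"
      using le_order_stat_iff size that by auto
    also have "\<dots> \<in> sets G" by measurable
    finally show "{w \<in> space G. a \<le> order_stat i (Z w)} \<in> sets G" .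
  qed
  then show "(\<lambda>w. \<lambda>i\<in>{1..n}. order_stat i (Z w)) \<in> measurable G (Pi\<^sub>M {1..n} (\<lambda>_. borel))"
    by (intro measurable_restrict) auto
qed

lemma measurable_add_mset_configurations:
  assumes Z: "Z \<in> measurable G (configurations n)" and z[measurable]: "z \<in> borel_measurable G"
  shows "(\<lambda>w. add_mset (z w) (Z w)) \<in> measurable G (configurations (Suc n))"
proof (rule measurable_configurationsI)
  fix a
  note [measurable] = measurable_tail_count[OF Z, of a]
  show "(\<lambda>w. tail_count a (add_mset (z w) (Z w))) \<in> measurable G (count_space UNIV)"
    unfolding tail_count_add_mset by measurable
qed (simp add: measurable_configuration_size[OF Z])

section \<open>The extreme point and the core\<close>

text \<open>
  The distance to \<open>c\<close> is a convex function, so on an interval it is maximal only at the end points;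
  which one wins depends on the position of \<open>c\<close> relative to the midpoint.
\<close>

lemma farthest_points_finite:
  fixes A :: "real set" and c :: real
  assumes fin: "finite A" and ne: "A \<noteq> {}"
  shows "{x \<in> A. \<forall>y\<in>A. dist y c \<le> dist x c} =
    (if Min A + Max A < 2 * c then {Min A} else if 2 * c < Min A + Max A then {Max A}
     else {Min A, Max A})"
proof -
  define l u where "l = Min A" and "u = Max A"
  have mem: "l \<in> A" "u \<in> A" using assms by (auto simp: l_def u_def)
  have bd: "l \<le> x" "x \<le> u" if "x \<in> A" for x using assms that by (auto simp: l_def u_def)
  have far: "x \<in> A \<and> (\<forall>y\<in>A. dist y c \<le> dist x c) \<longleftrightarrow>
    x \<in> A \<and> dist l c \<le> dist x c \<and> dist u c \<le> dist x c" for x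
  proof safe
    fix y assume "y \<in> A" "dist l c \<le> dist x c" "dist u c \<le> dist x c"
    with bd[of y] show "dist y c \<le> dist x c" by (auto simp: dist_real_def abs_if split: if_splits)
  qed (use mem in auto)
  have iff: "dist l c \<le> dist x c \<and> dist u c \<le> dist x c \<longleftrightarrow>
      (x = l \<and> l + u \<le> 2 * c) \<or> (x = u \<and> 2 * c \<le> l + u)" if "l \<le> x" "x \<le> u" for x
    using that unfolding dist_real_def by linarith
  have "x \<in> A \<and> (\<forall>y\<in>A. dist y c \<le> dist x c) \<longleftrightarrow>
      (x = l \<and> l + u \<le> 2 * c) \<or> (x = u \<and> 2 * c \<le> l + u)" for x
    unfolding far using mem bd iff by blast
  then show ?thesis
    unfolding l_def[symmetric] u_def[symmetric] by auto
qed

lemma extreme_point_eq: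
  fixes p :: real
  assumes "S \<noteq> {#}"
  defines "l \<equiv> Min (set_mset S)" and "u \<equiv> Max (set_mset S)" and "c \<equiv> centre_of_mass p S"
  shows "extreme_point p right S = (if l + u < 2 * c \<or> l + u = 2 * c \<and> \<not> right then l else u)"
proof -
  have "l \<le> u" using assms(1) by (simp add: l_def u_def)
  moreover have "farthest_points p S =
      (if l + u < 2 * c then {l} else if 2 * c < l + u then {u} else {l, u})"
    unfolding farthest_points_def l_def u_def c_def
    by (rule farthest_points_finite) (use assms(1) in auto)
  ultimately show ?thesis
    by (cases "l + u < 2 * c"; cases "2 * c < l + u") (simp_all add: extreme_point_def)
qed

lemma extreme_point_in_set: "S \<noteq> {#} \<Longrightarrow> extreme_point p right S \<in># S"
  by (simp add: extreme_point_eq)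

lemma measurable_core:
  assumes Z: "Z \<in> measurable G (configurations (Suc n))" and b[measurable]: "Measurable.pred G b"
  shows "(\<lambda>w. core p (b w) (Z w)) \<in> measurable G (configurations n)"
proof (rule measurable_configurationsI)
  have size: "size (Z w) = Suc n" if "w \<in> space G" for w
    using measurable_configuration_size[OF Z that] .
  then have ne: "Z w \<noteq> {#}" if "w \<in> space G" for w
    using that by fastforce
  show "size (core p (b w) (Z w)) = n" if "w \<in> space G" for w
    using size ne that by (simp add: core_def size_Diff_singleton extreme_point_in_set)
  define e where "e w = extreme_point p (b w) (Z w)" for w
  have [measurable]: "e \<in> borel_measurable G"
  proof -
    note [measurable] = measurable_order_stat[OF Z]
    define l u c where "l w = order_stat 1 (Z w)" and "u w = order_stat (Suc n) (Z w)"
      and "c w = p * ((\<Sum>i\<in>{1..Suc n}. order_stat i (Z w)) / real (Suc n))" for w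
    have [measurable]: "l \<in> borel_measurable G" "u \<in> borel_measurable G" "c \<in> borel_measurable G"
      unfolding l_def[abs_def] u_def[abs_def] c_def[abs_def] by measurable
    have "(\<lambda>w. if l w + u w < 2 * c w \<or> l w + u w = 2 * c w \<and> \<not> b w then l w else u w)
        \<in> borel_measurable G"
      by measurable
    moreover have "e w =
        (if l w + u w < 2 * c w \<or> l w + u w = 2 * c w \<and> \<not> b w then l w else u w)"
      if "w \<in> space G" for w
      unfolding e_def l_def u_def c_def extreme_point_eq[OF ne[OF that]] size[OF that, symmetric]
      by (simp only: ne[OF that] not_False_eq_True simp_thms Min_mset_order_stat Max_mset_order_stat
          centre_of_mass_def sum_mset_order_stats)
    ultimately show ?thesis by (simp cong: measurable_cong)
  qed
  fix a
  note [measurable] = measurable_tail_count[OF Z, of a]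
  have "(\<lambda>w. tail_count a (Z w) - of_bool (a \<le> e w)) \<in> measurable G (count_space UNIV)"
    by measurable
  moreover have "tail_count a (core p (b w) (Z w)) = tail_count a (Z w) - of_bool (a \<le> e w)"
    if "w \<in> space G" for w
    using tail_count_remove[OF extreme_point_in_set[OF ne[OF that]]]
    by (metis add_diff_cancel_right' core_def e_def)
  ultimately show "(\<lambda>w. tail_count a (core p (b w) (Z w))) \<in> measurable G (count_space UNIV)"
    by (simp cong: measurable_cong)
qed

section \<open>One step of the dynamics\<close>

text \<open>
  In a tie either point may have been removed, so both alternatives carry the weak inequality.
  Excluding one of them thus takes a strict inequality in the opposite direction.
\<close>

lemma core_cases:
  assumes "S \<noteq> {#}"
  obtains (lowest) "core p right S = S - {#Min (set_mset S)#}"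
      "Min (set_mset S) + Max (set_mset S) \<le> 2 * centre_of_mass p S"
  | (highest) "core p right S = S - {#Max (set_mset S)#}"
      "2 * centre_of_mass p S \<le> Min (set_mset S) + Max (set_mset S)"
  using assms by (cases "Min (set_mset S) + Max (set_mset S) < 2 * centre_of_mass p S \<or>
      Min (set_mset S) + Max (set_mset S) = 2 * centre_of_mass p S \<and> \<not> right")
    (auto simp: core_def extreme_point_eq)

lemma core_subset: "set_mset (core p right S) \<subseteq> set_mset S"
  unfolding core_def by (meson in_diffD subsetI)

lemma size_core: "S \<noteq> {#} \<Longrightarrow> size (core p right S) = size S - 1"
  by (simp add: core_def size_Diff_singleton extreme_point_in_set)

text \<open>
  Replacing every point at or above \<open>a\<close> by \<open>a\<close> and every other point by the lower bound \<open>l\<close> does not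
  increase the sum when \<open>l\<close> bounds all points from below. The companion bound is the mirror image.
\<close>

lemma sum_mset_ge_tail:
  assumes "\<forall>x\<in>#S. l \<le> x"
  shows "real (tail_count a S) * a + real (size S - tail_count a S) * l \<le> sum_mset S"
  using assms
proof (induction S)
  case (add x S)
  have "tail_count a S \<le> size S" by (rule tail_count_le_size)
  with add show ?case by (auto simp: Suc_diff_le algebra_simps)
qed (simp add: tail_count_def)

lemma sum_mset_le_tail:
  assumes "\<forall>x\<in>#S. x \<le> u"
  shows "sum_mset S \<le> real (tail_count a S) * u + real (size S - tail_count a S) * a"
  using assms
proof (induction S)
  case (add x S)
  have "tail_count a S \<le> size S" by (rule tail_count_le_size)
  with add show ?case by (auto simp: Suc_diff_le algebra_simps)
qed (simp add: tail_count_def)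

text \<open>
  Removing the largest point would require \<open>2 * p * sum \<le> n * (min + max)\<close>. If the new point is
  below \<open>1 / p\<close>, it is the minimum, the other \<open>n - 1\<close> points contribute at least \<open>2 * (n - 1)\<close>
  to the left-hand side, and \<open>max \<le> 1\<close>. Otherwise the left-hand side is at least
  \<open>2 * (n - 1) * p * min + 2 * p * max\<close>, where \<open>p * min \<ge> 1 \<ge> max \<ge> min\<close>. Both cases contradict
  the inequality because \<open>p > 1\<close>.
\<close>

lemma core_above_drops_lowest:
  assumes p: "p > 1" and size: "size Y \<ge> 2"
    and Y: "\<forall>x\<in>#Y. 1 / p \<le> x \<and> x \<le> 1" and z: "0 \<le> z" "z \<le> 1"
  shows "core p b (add_mset z Y) = add_mset z Y - {#Min (set_mset (add_mset z Y))#}"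
proof (rule core_cases[of "add_mset z Y" p b])
  define X where "X = add_mset z Y"
  define l u n where "l = Min (set_mset X)" and "u = Max (set_mset X)" and "n = real (size X)"
  have "X \<noteq> {#}" by (simp add: X_def)
  then have mem: "l \<in># X" "u \<in># X" by (simp_all add: l_def u_def)
  have bd: "\<forall>x\<in>#X. l \<le> x \<and> x \<le> u" by (simp add: l_def u_def)
  have lu: "l \<le> u" using bd mem by auto
  have X1: "0 \<le> x" "x \<le> 1" if "x \<in># X" for x
    using that z Y p by (auto simp: X_def intro: order_trans[of 0 "1 / p"])
  have n: "n \<ge> 3" using size by (simp add: n_def X_def)
  assume "2 * centre_of_mass p (add_mset z Y) \<le>
    Min (set_mset (add_mset z Y)) + Max (set_mset (add_mset z Y))"
  then have le: "2 * p * sum_mset X \<le> n * (l + u)"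
    using n by (simp add: centre_of_mass_def field_simps n_def flip: X_def l_def u_def)
  have "n * (l + u) < 2 * p * sum_mset X"
  proof (cases "l < 1 / p")
    case True
    then have "l = z" using mem(1) Y by (auto simp: X_def)
    have "real (size Y) * (1 / p) \<le> sum_mset Y"
      using sum_mset_ge_tail[of Y "1 / p" "1 / p"] Y
      by (auto simp: tail_count_eq_size_iff[THEN iffD2])
    then have "z + (n - 1) / p \<le> sum_mset X" by (simp add: X_def n_def)
    then have "2 * p * (z + (n - 1) / p) \<le> 2 * p * sum_mset X" using p by simp
    moreover have "2 * p * (z + (n - 1) / p) = 2 * p * z + 2 * (n - 1)"
      using p by (simp add: field_simps)
    ultimately have "2 * p * z + 2 * (n - 1) \<le> 2 * p * sum_mset X" by linarith
    moreover have "n * u \<le> n * 1" using X1(2)[OF mem(2)] n by (intro mult_left_mono) auto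
    moreover have "0 < (n - 2) * (1 - z) + 2 * z * (p - 1)"
    proof (cases "z = 1")
      case False
      then have "0 < (n - 2) * (1 - z)" using n z by simp
      then show ?thesis using z p by (simp add: add_pos_nonneg)
    qed (use p in auto)
    ultimately show ?thesis by (simp add: \<open>l = z\<close> algebra_simps)
  next
    case False
    have "\<forall>x\<in>#X - {#u#}. l \<le> x" using bd by (meson in_diffD)
    then have "real (size (X - {#u#})) * l \<le> sum_mset (X - {#u#})"
      using sum_mset_ge_tail[of "X - {#u#}" l l] by (auto simp: tail_count_eq_size_iff[THEN iffD2])
    then have "(n - 1) * l + u \<le> sum_mset X"
      using mem(2) n by (simp add: size_Diff_singleton sum_mset_diff n_def of_nat_diff)
    then have "2 * p * ((n - 1) * l + u) \<le> 2 * p * sum_mset X" using p by simp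
    moreover have "1 \<le> p * l" using False p by (simp add: field_simps)
    then have "2 * (n - 1) * u \<le> 2 * (n - 1) * (p * l)"
      using X1(2)[OF mem(2)] n by (intro mult_left_mono) auto
    moreover have "n * l \<le> n * u" using lu n by simp
    moreover have "0 < u" using False lu p by (smt (verit) divide_pos_pos)
    then have "0 < 2 * (p - 1) * u" using p by simp
    ultimately show ?thesis by (simp add: algebra_simps)
  qed
  with le show ?thesis by simp
qed simp

text \<open>
  The new point replaces the minimum (or is itself discarded as the minimum), so no count can drop.
  A new point at or above \<open>a\<close> raises the count for \<open>a\<close> unless the minimum is also at or above \<open>a\<close>,
  and then all points are.
\<close>

lemma core_above_step:
  fixes b :: bool
  assumes p: "p > 1" and size: "size Y \<ge> 2"
    and Y: "\<forall>x\<in>#Y. 1 / p \<le> x \<and> x \<le> 1" and z: "0 \<le> z" "z \<le> 1"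
  defines "Y' \<equiv> core p b (add_mset z Y)"
  shows "\<forall>x\<in>#Y'. 1 / p \<le> x"
    and "tail_count a Y \<le> tail_count a Y'"
    and "a \<le> z \<Longrightarrow> tail_count a Y < size Y \<Longrightarrow> tail_count a Y < tail_count a Y'"
proof -
  define X where "X = add_mset z Y"
  define l where "l = Min (set_mset X)"
  have "X \<noteq> {#}" by (simp add: X_def)
  then have mem: "l \<in># X" by (simp add: l_def)
  have bd: "l \<le> x" if "x \<in># X" for x using that by (simp add: l_def)
  have Y': "Y' = X - {#l#}"
    unfolding Y'_def X_def l_def by (rule core_above_drops_lowest[OF p size Y z])
  show "\<forall>x\<in>#Y'. 1 / p \<le> x"
  proof (cases "l < 1 / p")
    case True
    then have "l = z" using mem Y by (auto simp: X_def)
    then show ?thesis using Y by (simp add: Y' X_def)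
  next
    case False
    then show ?thesis using bd by (force simp: Y' dest: in_diffD)
  qed
  have cnt: "tail_count a Y' + of_bool (a \<le> l) = tail_count a Y + of_bool (a \<le> z)"
    using tail_count_remove[OF mem, of a] by (simp add: Y') (simp add: X_def)
  have full: "tail_count a Y = size Y" "a \<le> z" if "a \<le> l"
    using that bd by (auto simp: tail_count_eq_size_iff X_def intro: order_trans)
  show "tail_count a Y \<le> tail_count a Y'" using cnt full by (cases "a \<le> l") auto
  show "tail_count a Y < tail_count a Y'" if "a \<le> z" "tail_count a Y < size Y"
    using cnt full that by (cases "a \<le> l") auto
qed

text \<open>
  If the minimum were removed, it would be below \<open>\<eta>\<close>: otherwise the new core would have all its
  \<open>N - 1\<close> points above \<open>\<eta>\<close>. So at most \<open>N - K - 1\<close> of the \<open>N\<close> points, including the new one, are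
  above \<open>\<eta>\<close>, and \<open>small\<close> says that for a maximum of size \<open>e\<close> this is too little mass to remove the
  minimum; \<open>few\<close> extends the conclusion to larger maxima. Hence any maximum above \<open>e\<close> is removed.
  The bound \<open>Y'\<close> is imposed after the step because of the borderline case
  \<open>2 * p * (N - K) = N\<close>, in which a large new point may displace a small one.
\<close>

lemma collapse_step:
  fixes b :: bool
  assumes p: "p > 0" and size: "Suc (size Y) = N" and K: "1 \<le> K" "K < N"
    and Y: "\<forall>x\<in>#Y. 0 \<le> x" and z: "0 \<le> z"
    and eta: "0 < \<eta>" "\<eta> \<le> e"
    and few: "2 * p * real (N - K - 1) < real N"
    and small: "2 * p * (real (K + 1) * \<eta> + real (N - K - 1) * e) < real N * e"
  defines "Y' \<equiv> core p b (add_mset z Y)"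
  assumes Y': "tail_count \<eta> Y' < N - K"
  shows "tail_count e Y' \<le> tail_count e Y"
    and "z < e \<Longrightarrow> 0 < tail_count e Y \<Longrightarrow> tail_count e Y' < tail_count e Y"
proof -
  define X where "X = add_mset z Y"
  define l u where "l = Min (set_mset X)" and "u = Max (set_mset X)"
  have "X \<noteq> {#}" by (simp add: X_def)
  then have mem: "l \<in># X" "u \<in># X" by (simp_all add: l_def u_def)
  have bd: "\<forall>x\<in>#X. l \<le> x \<and> x \<le> u" by (simp add: l_def u_def)
  have lu: "0 \<le> l" "l \<le> u" using bd mem Y z by (auto simp: X_def)
  have sizeX: "size X = N" using size by (simp add: X_def)
  have main: "tail_count e Y' + of_bool (e \<le> u) \<le> tail_count e Y + of_bool (e \<le> z)"
  proof (cases "e \<le> u")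
    case False
    then have "tail_count e X = 0" using bd by (force simp: tail_count_eq_0_iff)
    then have "tail_count e Y' = 0"
      using core_subset[of p b X] by (auto simp: tail_count_eq_0_iff Y'_def simp flip: X_def)
    then show ?thesis using False by simp
  next
    case True
    have "Y' = X - {#u#}"
    proof (rule core_cases[of X p b])
      assume "core p b X = X - {#Min (set_mset X)#}"
        and c: "Min (set_mset X) + Max (set_mset X) \<le> 2 * centre_of_mass p X"
      then have eq: "Y' = X - {#l#}" by (simp add: Y'_def X_def l_def)
      have "l < \<eta>"
      proof (rule ccontr)
        assume "\<not> l < \<eta>"
        then have "tail_count \<eta> Y' = size Y'"
          using bd by (force simp: tail_count_eq_size_iff eq dest: in_diffD)
        then show False using Y' K mem sizeX by (simp add: eq size_Diff_singleton)
      qed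
      then have "tail_count \<eta> X = tail_count \<eta> Y'"
        using tail_count_remove[OF mem(1), of \<eta>] by (simp add: eq)
      then have cnt: "tail_count \<eta> X \<le> N - K - 1" using Y' by simp
      have "sum_mset X \<le> real (tail_count \<eta> X) * u + real (size X - tail_count \<eta> X) * \<eta>"
        using bd by (intro sum_mset_le_tail) auto
      also have "\<dots> = real N * \<eta> + real (tail_count \<eta> X) * (u - \<eta>)"
        using tail_count_le_size[of \<eta> X] by (simp add: sizeX of_nat_diff algebra_simps)
      also have "\<dots> \<le> real N * \<eta> + real (N - K - 1) * (u - \<eta>)"
        using cnt True eta by (intro add_left_mono mult_right_mono) auto
      also have "\<dots> = real (K + 1) * \<eta> + real (N - K - 1) * u"
        using K by (simp add: of_nat_diff algebra_simps)
      finally have "2 * p * sum_mset X \<le> 2 * p * (real (K + 1) * \<eta> + real (N - K - 1) * u)"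
        using p by simp
      \<comment> \<open>Split off the excess u - e of the maximum, on which few acts, from the level e, on which small acts.\<close>
      also have "\<dots> = 2 * p * (real (K + 1) * \<eta> + real (N - K - 1) * e)
          + 2 * p * real (N - K - 1) * (u - e)"
        by (simp add: algebra_simps)
      also have "\<dots> < real N * e + real N * (u - e)"
        using small mult_right_mono[OF less_imp_le[OF few], of "u - e"] True by simp
      finally have "2 * p * sum_mset X < real N * u" by (simp add: algebra_simps)
      also have "\<dots> \<le> real N * (l + u)" using lu by (intro mult_left_mono) auto
      finally have "2 * centre_of_mass p X < l + u"
        using K by (simp add: centre_of_mass_def sizeX field_simps)
      with c show ?thesis by (simp add: l_def u_def)
    qed (auto simp: Y'_def X_def u_def)
    then show ?thesis
      using tail_count_remove[OF mem(2), of e] by (simp add: X_def)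
  qed
  have "z \<le> u" using bd by (simp add: X_def)
  then show "tail_count e Y' \<le> tail_count e Y" using main by (cases "e \<le> z"; cases "e \<le> u") auto
  have "\<exists>x\<in>#Y. e \<le> x" if "0 < tail_count e Y"
    using that tail_count_eq_0_iff[of e Y] by (auto simp: not_less)
  then have "e \<le> u" if "0 < tail_count e Y"
    using that bd by (force simp: X_def)
  then show "tail_count e Y' < tail_count e Y" if "z < e" "0 < tail_count e Y"
    using main that \<open>0 < tail_count e Y \<Longrightarrow> e \<le> u\<close> by simp
qed

text \<open>
  The number of points outside the target window \<open>[e, v]\<close> decreases until nothing is left below
  \<open>e\<close>. A removed minimum below \<open>e\<close> was outside the window, and so was a removed maximum above \<open>v\<close>.
  The remaining possibility, a removed maximum inside the window while the minimum is below \<open>e\<close>,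
  is ruled out by \<open>top\<close> and \<open>bottom\<close>: with \<open>m\<close> points at least \<open>e\<close> and all others at least the
  minimum \<open>l\<close>, the removal condition is affine in \<open>l\<close>, and the two hypotheses exclude it at
  \<open>l = e\<close> and at \<open>l = a\<close>.

  The new point lies in the window, which is why \<open>m\<close> may exceed the number of core points above \<open>e\<close>
  by one.
\<close>

lemma climb_step:
  fixes b :: bool
  assumes p: "p > 0" and size: "Suc (size Y) = N" and m: "m \<le> N" "m \<le> tail_count e Y + 1"
    and Y: "\<forall>x\<in>#Y. a \<le> x" and a: "0 \<le> a" "a \<le> e" "0 < e"
    and z: "e \<le> z" "z \<le> v"
    and top: "e + v < 2 * p * e"
    and bottom: "real N * (a + v) < 2 * p * (real m * e + real (N - m) * a)"
  defines "Y' \<equiv> core p b (add_mset z Y)"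
  shows "\<forall>x\<in>#Y'. a \<le> x" and "m \<le> tail_count e Y' + 1"
    and "(\<forall>x\<in>#Y'. e \<le> x) \<or>
      size {#x \<in># Y'. x \<notin> {e..v}#} < size {#x \<in># Y. x \<notin> {e..v}#}"
proof -
  define X where "X = add_mset z Y"
  define l u where "l = Min (set_mset X)" and "u = Max (set_mset X)"
  have "X \<noteq> {#}" by (simp add: X_def)
  then have mem: "l \<in># X" "u \<in># X" by (simp_all add: l_def u_def)
  have bd: "\<forall>x\<in>#X. l \<le> x \<and> x \<le> u" by (simp add: l_def u_def)
  have sizeX: "size X = N" using size by (simp add: X_def)
  have aX: "\<forall>x\<in>#X. a \<le> x" using Y z a by (auto simp: X_def)
  have Y'X: "set_mset Y' \<subseteq> set_mset X" unfolding Y'_def X_def by (rule core_subset)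
  show "\<forall>x\<in>#Y'. a \<le> x" using Y'X aX by auto
  have ext: "extreme_point p b X \<in># X" by (rule extreme_point_in_set) (simp add: X_def)
  have mX: "m \<le> tail_count e X" using m z by (simp add: X_def)
  show "m \<le> tail_count e Y' + 1"
    using tail_count_remove[OF ext, of e] mX
    by (cases "e \<le> extreme_point p b X") (simp_all add: Y'_def core_def flip: X_def)
  have drop: "size {#x \<in># X - {#q#}. x \<notin> {e..v}#} < size {#x \<in># Y. x \<notin> {e..v}#}"
    if q: "q \<in># X" "q \<notin> {e..v}" for q
  proof -
    have "{#x \<in># Y. x \<notin> {e..v}#} = {#x \<in># X. x \<notin> {e..v}#}"
      using z by (simp add: X_def)
    also have "\<dots> = {#x \<in># add_mset q (X - {#q#}). x \<notin> {e..v}#}"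
      by (simp only: insert_DiffM[OF q(1)])
    also have "\<dots> = add_mset q {#x \<in># X - {#q#}. x \<notin> {e..v}#}"
      using q(2) by (simp only: filter_mset_add_mset not_False_eq_True if_True)
    finally show ?thesis by simp
  qed
  show "(\<forall>x\<in>#Y'. e \<le> x) \<or>
      size {#x \<in># Y'. x \<notin> {e..v}#} < size {#x \<in># Y. x \<notin> {e..v}#}"
  proof (cases "l < e")
    case False
    then have "\<forall>x\<in>#X. e \<le> x" using bd by (meson linorder_not_less order_trans)
    then show ?thesis using Y'X by blast
  next
    case True
    show ?thesis
    proof (rule core_cases[of X p b])
      assume "core p b X = X - {#Min (set_mset X)#}"
      then have "Y' = X - {#l#}" by (simp add: Y'_def X_def l_def)
      then show ?thesis using drop[OF mem(1)] True by simp
    next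
      assume "core p b X = X - {#Max (set_mset X)#}"
        and c: "2 * centre_of_mass p X \<le> Min (set_mset X) + Max (set_mset X)"
      then have Y': "Y' = X - {#u#}" by (simp add: Y'_def X_def u_def)
      have "v < u"
      proof (rule ccontr)
        assume "\<not> v < u"
        have "real m * e + real (N - m) * l = real N * l + real m * (e - l)"
          using m by (simp add: of_nat_diff algebra_simps)
        also have "\<dots> \<le> real N * l + real (tail_count e X) * (e - l)"
          using mX True by (intro add_left_mono mult_right_mono) auto
        also have "\<dots> = real (tail_count e X) * e + real (size X - tail_count e X) * l"
          using tail_count_le_size[of e X] by (simp add: sizeX of_nat_diff algebra_simps)
        also have "\<dots> \<le> sum_mset X" using bd by (intro sum_mset_ge_tail) auto
        finally have sum: "2 * p * (real m * e + real (N - m) * l) \<le> 2 * p * sum_mset X"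
          using p by simp
        \<comment> \<open>f is affine and positive at a and at e, hence positive at l in between.\<close>
        define f where "f y = 2 * p * (real m * e + real (N - m) * y) - real N * (y + v)" for y
        have N: "0 < real N" using size by auto
        have fa: "0 < f a" using bottom by (simp add: f_def)
        have "f e = real N * (2 * p * e - (e + v))"
          using m by (simp add: f_def of_nat_diff algebra_simps)
        then have fe: "0 < f e" using N top by simp
        have al: "a \<le> l" using aX mem by auto
        have "(e - a) * f l = (e - l) * f a + (l - a) * f e" by (simp add: f_def algebra_simps)
        moreover have "0 < (e - l) * f a" using fa True by simp
        moreover have "0 \<le> (l - a) * f e" using fe al by simp
        ultimately have "0 < (e - a) * f l" by linarith
        then have "0 < f l" using al True by (simp add: zero_less_mult_iff)
        then have "real N * (l + v) < 2 * p * sum_mset X" using sum by (simp add: f_def)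
        then have "l + v < 2 * centre_of_mass p X"
          using N by (simp add: centre_of_mass_def sizeX field_simps)
        with c \<open>\<not> v < u\<close> show False by (simp add: l_def u_def)
      qed
      then show ?thesis using drop[OF mem(2)] by (simp add: Y')
    qed (simp add: X_def)
  qed
qed

section \<open>Steering\<close>

text \<open>
  Steering is deterministic: the new points are confined to a finite list of open intervals, and
  all their possible values and all outcomes of the coins are taken into account. Working with
  lists of intervals keeps the later probabilistic step uniform and makes steering transitive by
  concatenation.
\<close>

fun reachable :: "real \<Rightarrow> (real \<times> real) list \<Rightarrow> real multiset \<Rightarrow> real multiset set" where
  "reachable p [] Y = {Y}"
| "reachable p ((l, u) # I) Y =
     (\<Union>z\<in>{l<..<u}. \<Union>b. reachable p I (core p b (add_mset z Y)))"

definition steers :: "real \<Rightarrow> (real multiset \<Rightarrow> bool) \<Rightarrow> (real multiset \<Rightarrow> bool) \<Rightarrow> bool" where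
  "steers p P Q \<longleftrightarrow>
     (\<exists>I. (\<forall>(l, u)\<in>set I. 0 \<le> l \<and> l < u \<and> u \<le> 1) \<and> (\<forall>Y. P Y \<longrightarrow> reachable p I Y \<subseteq> Collect Q))"

lemma reachable_append: "reachable p (I @ J) Y = (\<Union>Z\<in>reachable p I Y. reachable p J Z)"
  by (induction p I Y rule: reachable.induct) auto

lemma reachable_trajectory:
  assumes step: "\<And>t. Y (Suc t) = core p (b t) (add_mset (z t) (Y t))"
    and z: "\<forall>j<length I. z (t + j) \<in> {fst (I ! j)<..<snd (I ! j)}"
  shows "Y (t + length I) \<in> reachable p I (Y t)"
  using z
proof (induction I arbitrary: t)
  case (Cons lu I)
  obtain l u where lu: "lu = (l, u)" by (cases lu)
  have "Y (Suc t + length I) \<in> reachable p I (Y (Suc t))"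
  proof (rule Cons.IH, intro allI impI)
    fix j assume "j < length I"
    then show "z (Suc t + j) \<in> {fst (I ! j)<..<snd (I ! j)}"
      using Cons.prems[rule_format, of "Suc j"] by simp
  qed
  moreover have "z t \<in> {l<..<u}" using Cons.prems[rule_format, of 0] lu by simp
  ultimately show ?case unfolding lu step by auto
qed simp

lemma steers_mono: "(\<And>Y. P Y \<Longrightarrow> Q Y) \<Longrightarrow> steers p P Q"
  unfolding steers_def by (rule exI[of _ "[]"]) auto

lemma steers_trans:
  assumes "steers p P Q" "steers p Q R"
  shows "steers p P R"
proof -
  from assms obtain I J where
    "\<forall>(l, u)\<in>set I. 0 \<le> l \<and> l < u \<and> u \<le> 1" "\<forall>(l, u)\<in>set J. 0 \<le> l \<and> l < u \<and> u \<le> 1"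
    "\<forall>Y. P Y \<longrightarrow> reachable p I Y \<subseteq> Collect Q" "\<forall>Y. Q Y \<longrightarrow> reachable p J Y \<subseteq> Collect R"
    unfolding steers_def by blast
  then show ?thesis
    unfolding steers_def by (intro exI[of _ "I @ J"]) (fastforce simp: reachable_append)
qed

text \<open>
  At most \<open>N - 1\<close> points lie outside the window at the start, and each step of \<open>climb_step\<close> either
  reduces their number or leaves no point below \<open>e\<close>; the latter persists because the new points
  exceed \<open>e\<close>. So \<open>N\<close> repetitions of the window suffice.
\<close>

lemma steers_climb:
  assumes p: "p > 0" and m: "m \<le> N" and a: "0 \<le> a" "a \<le> e" "0 < e" and v: "e < v" "v \<le> 1"
    and top: "e + v < 2 * p * e"
    and bottom: "real N * (a + v) < 2 * p * (real m * e + real (N - m) * a)"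
  shows "steers p
    (\<lambda>Y. Suc (size Y) = N \<and> (\<forall>x\<in>#Y. a \<le> x) \<and> m \<le> tail_count e Y + 1)
    (\<lambda>Y. Suc (size Y) = N \<and> (\<forall>x\<in>#Y. e \<le> x))"
proof -
  define out where "out Y = size {#x \<in># Y. x \<notin> {e..v}#}" for Y
  \<comment> \<open>The budget k bounds the points outside the window; it becomes irrelevant once all points are at least e.\<close>
  have "reachable p (replicate k (e, v)) Y \<subseteq> {Y. Suc (size Y) = N \<and> (\<forall>x\<in>#Y. e \<le> x)}"
    if "Suc (size Y) = N" "\<forall>x\<in>#Y. a \<le> x" "m \<le> tail_count e Y + 1"
      and "(\<forall>x\<in>#Y. e \<le> x) \<or> out Y \<le> k" for k Y
    using that
  proof (induction k arbitrary: Y)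
    case 0
    have "\<forall>x\<in>#Y. e \<le> x" if "out Y = 0"
      using that by (auto simp: out_def filter_mset_eq_mempty_iff)
    with 0 show ?case by auto
  next
    case (Suc k)
    show ?case
    proof (simp, intro UN_least)
      fix z b assume z: "z \<in> {e<..<v}"
      let ?Y = "core p b (add_mset z Y)"
      have "e \<le> z" "z \<le> v" using z by auto
      note step = climb_step[OF p Suc.prems(1) m Suc.prems(3,2) a this top bottom, of b]
      have "(\<forall>x\<in>#?Y. e \<le> x) \<or> out ?Y \<le> k"
      proof (cases "\<forall>x\<in>#Y. e \<le> x")
        case True
        then have "\<forall>x\<in>#add_mset z Y. e \<le> x" using z by simp
        then show ?thesis using core_subset[of p b "add_mset z Y"] by blast
      next
        case False
        then show ?thesis using step(3) Suc.prems(4) unfolding out_def by linarith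
      qed
      moreover have "Suc (size ?Y) = N" using Suc.prems(1) by (simp add: size_core)
      ultimately
      show "reachable p (replicate k (e, v)) ?Y \<subseteq> {Y. Suc (size Y) = N \<and> (\<forall>x\<in>#Y. e \<le> x)}"
        using step(1,2) by (intro Suc.IH)
    qed
  qed
  note drive = this
  have out: "out Y \<le> N" if "Suc (size Y) = N" for Y
    using that size_filter_mset_lesseq[of "\<lambda>x. x \<notin> {e..v}" Y] unfolding out_def by linarith
  show ?thesis
    unfolding steers_def
  proof (intro exI conjI allI impI)
    show "\<forall>(l, u)\<in>set (replicate N (e, v)). 0 \<le> l \<and> l < u \<and> u \<le> 1" using a v by auto
    fix Y assume "Suc (size Y) = N \<and> (\<forall>x\<in>#Y. a \<le> x) \<and> m \<le> tail_count e Y + 1"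
    then show "reachable p (replicate N (e, v)) Y \<subseteq> {Y. Suc (size Y) = N \<and> (\<forall>x\<in>#Y. e \<le> x)}"
      using drive out by blast
  qed
qed

text \<open>
  Once all points are at least \<open>a\<close>, the level can be raised to \<open>r * a\<close> because even \<open>N\<close> points at
  \<open>a\<close> have \<open>2 * p\<close> times their mean above \<open>a + r * (r * a)\<close> when \<open>1 + r * r < 2 * p\<close>. So
  \<open>climb_step\<close> applies with \<open>m = 0\<close>. Truncating at \<open>1 / p\<close> keeps the window \<open>[e', r * e']\<close> inside
  \<open>[0, 1]\<close>, as \<open>r \<le> p\<close>.
\<close>

lemma steers_ladder:
  assumes p: "p > 1" and N: "N > 0" and e: "0 < e" "e \<le> 1 / p"
  shows "steers p
    (\<lambda>Y. Suc (size Y) = N \<and> (\<forall>x\<in>#Y. e \<le> x)) (\<lambda>Y. Suc (size Y) = N \<and> (\<forall>x\<in>#Y. 1 / p \<le> x))"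
proof -
  define r where "r = 1 + min 1 ((p - 1) / 2)"
  have r: "1 < r" "r \<le> p" "1 + r * r < 2 * p"
  proof -
    define d where "d = min 1 ((p - 1) / 2)"
    have d: "0 < d" "d \<le> 1" "d \<le> (p - 1) / 2" using p by (auto simp: d_def min_def field_simps)
    have rd: "r = 1 + d" by (simp add: r_def d_def)
    have "1 + r * r = 2 + 2 * d + d * d" by (simp add: rd algebra_simps)
    also have "\<dots> \<le> 2 + 2 * d + d * 1" using d by (intro add_left_mono mult_left_mono) auto
    also have "\<dots> < 2 * p" using d by simp
    finally show "1 + r * r < 2 * p" .
    show "1 < r" "r \<le> p" using d by (auto simp: rd)
  qed
  have up: "steers p
     (\<lambda>Y. Suc (size Y) = N \<and> (\<forall>x\<in>#Y. e \<le> x))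
     (\<lambda>Y. Suc (size Y) = N \<and> (\<forall>x\<in>#Y. min (r ^ k * e) (1 / p) \<le> x))" for k
  proof (induction k)
    case 0
    then show ?case using e by (intro steers_mono) auto
  next
    case (Suc k)
    define a e' where "a = min (r ^ k * e) (1 / p)" and "e' = min (r ^ Suc k * e) (1 / p)"
    have ae: "0 < a" "a \<le> e'" "e' \<le> r * a" "e' \<le> 1 / p"
    proof -
      define q P where "q = r ^ k * e" and "P = 1 / p"
      have pos: "0 < q" "0 < P" using e r p by (auto simp: q_def P_def)
      have grow: "q \<le> r * q" "P \<le> r * P"
        using mult_right_mono[of 1 r q] mult_right_mono[of 1 r P] r pos by auto
      have "a = min q P" "e' = min (r * q) P" "r * a = min (r * q) (r * P)"
        using r by (simp_all add: a_def e'_def q_def P_def mult.assoc min_mult_distrib_left)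
      then show "0 < a" "a \<le> e'" "e' \<le> r * a" "e' \<le> 1 / p"
        unfolding P_def[symmetric] using pos grow by (linarith)+
    qed
    have "r * e' \<le> r * (1 / p)" using ae r by (intro mult_left_mono) auto
    also have "\<dots> \<le> 1" using r p by (simp add: field_simps)
    finally have v: "r * e' \<le> 1" .
    have "(1 + r) * e' < (2 * p) * e'"
    proof (rule mult_strict_right_mono)
      have "1 * r < r * r" using r by (intro mult_strict_right_mono) auto
      then show "1 + r < 2 * p" using r by simp
    qed (use ae in auto)
    then have top: "e' + r * e' < 2 * p * e'" by (simp add: algebra_simps)
    have "r * e' \<le> r * (r * a)" using ae r by (intro mult_left_mono) auto
    moreover have "(1 + r * r) * a < 2 * p * a" using r ae by (intro mult_strict_right_mono) auto
    ultimately have "a + r * e' < 2 * p * a" by (simp add: algebra_simps)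
    then have "real N * (a + r * e') < real N * (2 * p * a)" using N by simp
    then have "real N * (a + r * e') < 2 * p * (real 0 * e' + real (N - 0) * a)"
      by (simp add: algebra_simps)
    from steers_climb[OF _ _ _ _ _ _ v top this] ae r p
    have "steers p
      (\<lambda>Y. Suc (size Y) = N \<and> (\<forall>x\<in>#Y. a \<le> x)) (\<lambda>Y. Suc (size Y) = N \<and> (\<forall>x\<in>#Y. e' \<le> x))"
      by simp
    with Suc show ?case unfolding a_def e'_def by (rule steers_trans)
  qed
  obtain k where "1 / p / e < r ^ k" using real_arch_pow[OF r(1)] by blast
  then have "1 / p < r ^ k * e" using e(1) by (simp only: pos_divide_less_eq)
  then have "min (r ^ k * e) (1 / p) = 1 / p" by simp
  with up[of k] show ?thesis by simp
qed

text \<open>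
  The first climb starts from \<open>a = 0\<close>, since the \<open>k - 1\<close> lowest points may be at \<open>0\<close>. There
  \<open>climb_step\<close> asks for \<open>N * r < 2 * p * m\<close> with \<open>m = N - k + 1\<close>, which some \<open>r > 1\<close> satisfies by
  the hypothesis on \<open>k\<close>.
\<close>

lemma steers_escape:
  assumes p: "p > 1" and k: "1 \<le> k" "k < N" "real N < 2 * p * real (N - k + 1)" and e: "0 < e"
  shows "steers p
    (\<lambda>Y. Suc (size Y) = N \<and> (\<forall>x\<in>#Y. 0 \<le> x) \<and> N - k \<le> tail_count e Y)
    (\<lambda>Y. Suc (size Y) = N \<and> (\<forall>x\<in>#Y. 1 / p \<le> x))"
proof -
  define e' where "e' = min e (1 / p)"
  define m where "m = N - k + 1"
  have e': "0 < e'" "e' \<le> e" "e' \<le> 1 / p" using e p by (auto simp: e'_def)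
  obtain r where r: "1 < r" "r < 2 * p - 1" "real N * r < 2 * p * real m" "r < p"
  proof -
    have N: "0 < real N" using k by auto
    have "1 < min (min (2 * p - 1) p) (2 * p * real m / real N)"
      using p k N by (simp add: m_def field_simps)
    then obtain r where "1 < r" "r < min (min (2 * p - 1) p) (2 * p * real m / real N)"
      using dense by blast
    then show thesis using N by (intro that[of r]) (auto simp: field_simps)
  qed
  have "r * e' \<le> r * (1 / p)" using e' r by (intro mult_left_mono) auto
  also have "\<dots> \<le> 1" using r p by (simp add: field_simps)
  finally have v: "r * e' \<le> 1" .
  have "(1 + r) * e' < (2 * p) * e'" using r e' by (intro mult_strict_right_mono) auto
  then have top: "e' + r * e' < 2 * p * e'" by (simp add: algebra_simps)
  have "(real N * r) * e' < (2 * p * real m) * e'" using r e' by (intro mult_strict_right_mono) auto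
  then have bottom: "real N * (0 + r * e') < 2 * p * (real m * e' + real (N - m) * 0)"
    by (simp add: algebra_simps)
  have "m \<le> N" using k by (simp add: m_def)
  from steers_climb[OF _ this _ _ _ _ v top bottom] e' r p
  have "steers p
      (\<lambda>Y. Suc (size Y) = N \<and> (\<forall>x\<in>#Y. 0 \<le> x) \<and> m \<le> tail_count e' Y + 1)
      (\<lambda>Y. Suc (size Y) = N \<and> (\<forall>x\<in>#Y. e' \<le> x))"
    by simp
  moreover have "steers p
      (\<lambda>Y. Suc (size Y) = N \<and> (\<forall>x\<in>#Y. 0 \<le> x) \<and> N - k \<le> tail_count e Y)
      (\<lambda>Y. Suc (size Y) = N \<and> (\<forall>x\<in>#Y. 0 \<le> x) \<and> m \<le> tail_count e' Y + 1)"
  proof (intro steers_mono)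
    fix Y assume "Suc (size Y) = N \<and> (\<forall>x\<in>#Y. 0 \<le> x) \<and> N - k \<le> tail_count e Y"
    with tail_count_antimono[OF e'(2), of Y]
    show "Suc (size Y) = N \<and> (\<forall>x\<in>#Y. 0 \<le> x) \<and> m \<le> tail_count e' Y + 1"
      by (simp add: m_def)
  qed
  moreover have "steers p
      (\<lambda>Y. Suc (size Y) = N \<and> (\<forall>x\<in>#Y. e' \<le> x)) (\<lambda>Y. Suc (size Y) = N \<and> (\<forall>x\<in>#Y. 1 / p \<le> x))"
    using e' p k by (intro steers_ladder) auto
  ultimately show ?thesis by (blast intro: steers_trans)
qed

text \<open>
  The largest rank from which escape is possible also satisfies the condition for the collapse.
  Rank \<open>1\<close> is always admissible as \<open>p > 1\<close>. If \<open>K + 1 < N\<close> is not admissible, then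
  \<open>2 * p * (N - K) \<le> N\<close>, and one large point fewer makes this strict even in the case of equality.
\<close>

lemma critical_rank_exists:
  assumes "p > 1" "N \<ge> 2"
  obtains K where "1 \<le> K" "K < N" "real N < 2 * p * real (N - K + 1)"
    "2 * p * real (N - K - 1) < real N"
proof -
  define S where "S = {k \<in> {1..<N}. real N < 2 * p * real (N - k + 1)}"
  have N: "0 < real N" using assms by simp
  have "1 * real N < (2 * p) * real N" using assms N by (intro mult_strict_right_mono) linarith+
  moreover have "N - 1 + 1 = N" using assms by simp
  ultimately have "1 \<in> S" using assms(2) by (simp add: S_def)
  moreover have "finite S" by (simp add: S_def)
  ultimately obtain K where K: "K \<in> S" and greatest: "\<And>k. k \<in> S \<Longrightarrow> k \<le> K"
    using Max_in[of S] Max_ge[of S] by blast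
  have K': "1 \<le> K" "K < N" "real N < 2 * p * real (N - K + 1)" using K unfolding S_def mem_Collect_eq atLeastLessThan_iff by blast+
  have "2 * p * real (N - K - 1) < real N"
  proof (cases "Suc K < N")
    case True
    have eq: "N - Suc K + 1 = N - K" using True by linarith
    have "Suc K \<notin> S" using greatest[of "Suc K"] by linarith
    then have "\<not> real N < 2 * p * real (N - Suc K + 1)" using True unfolding S_def by simp
    then have "2 * p * real (N - K) \<le> real N" unfolding eq by linarith
    moreover have "2 * p * real (N - K - 1) < 2 * p * real (N - K)"
      using assms(1) K'(2) by (intro mult_strict_left_mono) simp_all
    ultimately show ?thesis by linarith
  next
    case False
    then have "N - K - 1 = 0" using K' by linarith
    then show ?thesis using N by (simp only: of_nat_0 mult_zero_right)
  qed
  with K' show thesis by (rule that)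
qed

section \<open>Trajectories\<close>

lemma eventually_zero_if_decreasing:
  fixes f :: "nat \<Rightarrow> nat"
  assumes le: "\<forall>\<^sub>F t in sequentially. f (Suc t) \<le> f t"
    and less: "\<exists>\<^sub>F t in sequentially. 0 < f t \<longrightarrow> f (Suc t) < f t"
  shows "\<forall>\<^sub>F t in sequentially. f t = 0"
proof -
  obtain T where T: "\<And>t. T \<le> t \<Longrightarrow> f (Suc t) \<le> f t"
    using le unfolding eventually_sequentially by blast
  obtain s where s: "T \<le> s" "\<And>t. T \<le> t \<Longrightarrow> f s \<le> f t"
    using ex_has_least_nat[of "\<lambda>t. T \<le> t" T f] by blast
  have const: "f t = f s" if "s \<le> t" for t
    using that
  proof (induction rule: dec_induct)
    case (step t)
    then show ?case using T[of t] s(1) s(2)[of "Suc t"] by linarith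
  qed (rule refl)
  obtain t where t: "s \<le> t" "0 < f t \<longrightarrow> f (Suc t) < f t"
    using less[unfolded frequently_sequentially, THEN spec, of s] by (elim exE conjE)
  have "f t = f s" "f (Suc t) = f s" using t(1) by (auto intro!: const)
  with t have "f s = 0" by linarith
  have "f t = 0" if "s \<le> t" for t
    using const[OF that] \<open>f s = 0\<close> by linarith
  then show ?thesis unfolding eventually_sequentially by blast
qed

text \<open>
  A single realisation: \<open>Y t\<close> is the core at time \<open>t\<close>, and \<open>z t\<close>, \<open>b t\<close> are the replacement
  point and the coin that lead from \<open>Y t\<close> to \<open>Y (Suc t)\<close>; their indices are one less than in the
  process.
\<close>

locale trajectory =
  fixes p :: real and N :: nat and Y :: "nat \<Rightarrow> real multiset" and z :: "nat \<Rightarrow> real"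
    and b :: "nat \<Rightarrow> bool"
  assumes p: "p > 1" and N: "N \<ge> 3"
    and Y_step: "\<And>t. Y (Suc t) = core p (b t) (add_mset (z t) (Y t))"
    and Y_size: "\<And>t. Suc (size (Y t)) = N"
    and Y_unit: "\<And>t. set_mset (Y t) \<subseteq> {0..1}"
    and z_unit: "\<And>t. z t \<in> {0..1}"
begin

lemma above_step:
  assumes "\<forall>x\<in>#Y t. 1 / p \<le> x"
  shows "\<forall>x\<in>#Y (Suc t). 1 / p \<le> x"
    and "tail_count a (Y t) \<le> tail_count a (Y (Suc t))"
    and "a \<le> z t \<Longrightarrow> tail_count a (Y t) < size (Y t) \<Longrightarrow>
      tail_count a (Y t) < tail_count a (Y (Suc t))"
proof -
  have "2 \<le> size (Y t)" using Y_size[of t] N by linarith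
  moreover have "x \<le> 1" if "x \<in># Y t" for x using that Y_unit[of t] by auto
  moreover have "0 \<le> z t" "z t \<le> 1" using z_unit[of t] by simp_all
  ultimately have args: "2 \<le> size (Y t)" "\<forall>x\<in>#Y t. 1 / p \<le> x \<and> x \<le> 1" "0 \<le> z t" "z t \<le> 1"
    using assms by blast+
  show "\<forall>x\<in>#Y (Suc t). 1 / p \<le> x"
    unfolding Y_step by (rule core_above_step(1)[OF p args])
  show "tail_count a (Y t) \<le> tail_count a (Y (Suc t))"
    unfolding Y_step by (rule core_above_step(2)[OF p args])
  show "tail_count a (Y t) < tail_count a (Y (Suc t))" if "a \<le> z t" "tail_count a (Y t) < size (Y t)"
    unfolding Y_step by (rule core_above_step(3)[OF p args that])
qed

lemma stays_above:
  assumes "\<forall>x\<in>#Y T. 1 / p \<le> x" "T \<le> t"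
  shows "\<forall>x\<in>#Y t. 1 / p \<le> x"
  using assms(2)
proof (induction rule: dec_induct)
  case (step t)
  then show ?case by (intro above_step(1))
qed (use assms in simp)

text \<open>
  The number of points below \<open>a\<close> never increases and drops whenever \<open>z t \<ge> a\<close>, as long as it is
  positive.
\<close>

lemma above_rises:
  assumes above: "\<forall>x\<in>#Y T. 1 / p \<le> x" and freq: "\<exists>\<^sub>F t in sequentially. a \<le> z t"
  shows "\<forall>\<^sub>F t in sequentially. \<forall>x\<in>#Y t. a \<le> x"
proof -
  note up = above_step(2,3)[OF stays_above[OF above]]
  define f where "f t = size (Y t) - tail_count a (Y t)" for t
  have size: "size (Y (Suc t)) = size (Y t)" for t using Y_size[of t] Y_size[of "Suc t"] by simp
  have "\<forall>\<^sub>F t in sequentially. f t = 0"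
  proof (rule eventually_zero_if_decreasing)
    show "\<forall>\<^sub>F t in sequentially. f (Suc t) \<le> f t"
      unfolding eventually_sequentially f_def size using up(1)
      by (intro exI[of _ T]) (simp add: diff_le_mono2)
    show "\<exists>\<^sub>F t in sequentially. 0 < f t \<longrightarrow> f (Suc t) < f t"
      unfolding frequently_sequentially
    proof
      fix m
      obtain t where "max m T \<le> t" "a \<le> z t" 
        using freq[unfolded frequently_sequentially, THEN spec, of "max m T"] by (elim exE conjE)
      then have "0 < f t \<longrightarrow> f (Suc t) < f t" using up(2)[of t a] by (auto simp: f_def size intro: diff_less_mono2)
      then show "\<exists>t\<ge>m. 0 < f t \<longrightarrow> f (Suc t) < f t" using \<open>max m T \<le> t\<close> by auto
    qed
  qed
  then show ?thesis
  proof eventually_elim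
    case (elim t)
    then have "tail_count a (Y t) = size (Y t)"
      using tail_count_le_size[of a "Y t"] by (simp add: f_def)
    then show ?case by (simp add: tail_count_eq_size_iff)
  qed
qed

text \<open>
  From some time on \<open>collapse_step\<close> applies at every step, so the number of points above \<open>e\<close> never
  increases and drops whenever \<open>z t < e\<close>, as long as it is positive.
\<close>

lemma collapses:
  assumes K: "1 \<le> K" "K < N" "2 * p * real (N - K - 1) < real N"
    and few: "\<And>\<eta>. 0 < \<eta> \<Longrightarrow> \<forall>\<^sub>F t in sequentially. tail_count \<eta> (Y t) < N - K"
    and freq: "\<exists>\<^sub>F t in sequentially. z t < e" and e: "0 < e"
  shows "\<forall>\<^sub>F t in sequentially. \<forall>x\<in>#Y t. x < e"
proof -
  define g where "g = real N - 2 * p * real (N - K - 1)"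
  \<comment> \<open>The gap g is positive by the choice of K; the choice of eta makes the share of K + 1 points at eta at most half of g * e.\<close>
  define \<eta> where "\<eta> = min e (g * e / (4 * p * real (K + 1)))"
  have g: "0 < g" using K by (simp add: g_def)
  have eta: "0 < \<eta>" "\<eta> \<le> e" using g e p by (auto simp: \<eta>_def)
  have "\<eta> * (4 * p * real (K + 1)) \<le> g * e"
    using p min.cobounded2[of e "g * e / (4 * p * real (K + 1))", folded \<eta>_def]
    by (simp only: pos_le_divide_eq[of "4 * p * real (K + 1)"] mult_pos_pos)
  moreover have "0 < g * e" using g e by simp
  ultimately have "2 * p * (real (K + 1) * \<eta>) < g * e" by (simp add: algebra_simps)
  then have small: "2 * p * (real (K + 1) * \<eta> + real (N - K - 1) * e) < real N * e"
    by (simp add: g_def algebra_simps)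
  have down: "tail_count e (Y (Suc t)) \<le> tail_count e (Y t)"
      "z t < e \<Longrightarrow> 0 < tail_count e (Y t) \<Longrightarrow> tail_count e (Y (Suc t)) < tail_count e (Y t)"
    if "tail_count \<eta> (Y (Suc t)) < N - K" for t
  proof -
    have pos: "0 < p" "\<forall>x\<in>#Y t. 0 \<le> x" "0 \<le> z t" using p Y_unit[of t] z_unit[of t] by auto
    note step = collapse_step[OF pos(1) Y_size K(1,2) pos(2,3) eta K(3) small, of "b t",
        folded Y_step, OF that]
    show "tail_count e (Y (Suc t)) \<le> tail_count e (Y t)" by (rule step(1))
    show "tail_count e (Y (Suc t)) < tail_count e (Y t)" if "z t < e" "0 < tail_count e (Y t)"
      using that by (rule step(2))
  qed
  obtain T where T: "\<And>t. T \<le> t \<Longrightarrow> tail_count \<eta> (Y t) < N - K"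
    using few[OF eta(1)] unfolding eventually_sequentially by blast
  have "\<forall>\<^sub>F t in sequentially. tail_count e (Y t) = 0"
  proof (rule eventually_zero_if_decreasing)
    show "\<forall>\<^sub>F t in sequentially. tail_count e (Y (Suc t)) \<le> tail_count e (Y t)"
      unfolding eventually_sequentially
    proof (intro exI[of _ T] allI impI)
      fix t assume "T \<le> t"
      then show "tail_count e (Y (Suc t)) \<le> tail_count e (Y t)" by (intro down(1) T) simp
    qed
    show "\<exists>\<^sub>F t in sequentially. 0 < tail_count e (Y t) \<longrightarrow>
        tail_count e (Y (Suc t)) < tail_count e (Y t)"
      unfolding frequently_sequentially
    proof
      fix m
      obtain t where "max m T \<le> t" "z t < e" 
        using freq[unfolded frequently_sequentially, THEN spec, of "max m T"] by (elim exE conjE)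
      then have "0 < tail_count e (Y t) \<longrightarrow> tail_count e (Y (Suc t)) < tail_count e (Y t)"
        using down(2)[of t] T[of "Suc t"] by simp
      then show "\<exists>t\<ge>m. 0 < tail_count e (Y t) \<longrightarrow> tail_count e (Y (Suc t)) < tail_count e (Y t)"
        using \<open>max m T \<le> t\<close> by auto
    qed
  qed
  then show ?thesis by (simp add: tail_count_eq_0_iff)
qed

end

section \<open>The history of the process\<close>

context p_contest
begin

text \<open>
  What is known at time \<open>t\<close>: the initial configuration, the replacement points up to \<open>\<zeta> t\<close> and the
  coins up to \<open>B t\<close>. The coin of time \<open>t\<close> is included because it determines the core at time \<open>t\<close>;
  the next replacement point \<open>\<zeta> (Suc t)\<close> is still independent of all this.
\<close>

definition source :: "randomness \<Rightarrow> 'a set set" where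
  "source s = (case s of
     Initial \<Rightarrow> sets (vimage_algebra (space M) (X 0) (configurations N))
   | Replacement t \<Rightarrow> sets (vimage_algebra (space M) (\<zeta> t) borel)
   | Coin t \<Rightarrow> sets (vimage_algebra (space M) (B t) (count_space UNIV)))"

definition past :: "nat \<Rightarrow> randomness set" where
  "past t = {Initial} \<union> Replacement ` {1..t} \<union> Coin ` {..t}"

definition history :: "nat \<Rightarrow> 'a measure" where
  "history t = sigma (space M) (\<Union>s\<in>past t. source s)"

lemma source_independent: "indep_sets source ({Initial} \<union> Replacement ` {1..} \<union> range Coin)"
  using independent unfolding source_def[abs_def] .

lemma source_events: "s \<in> past t \<Longrightarrow> source s \<subseteq> events"
proof -
  assume "s \<in> past t"
  then have "s \<in> {Initial} \<union> Replacement ` {1..} \<union> range Coin" unfolding past_def by auto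
  with source_independent[unfolded indep_sets_def, THEN conjunct1]
  show ?thesis by (rule bspec)
qed

lemma past_mono: "s \<le> t \<Longrightarrow> past s \<subseteq> past t"
  by (auto simp: past_def)

lemma space_history [simp]: "space (history t) = space M"
  by (simp add: history_def space_measure_of_conv)

lemma sets_history: "sets (history t) = sigma_sets (space M) (\<Union>s\<in>past t. source s)"
  unfolding history_def
proof (rule sets_measure_of, intro UN_least)
  fix s assume "s \<in> past t"
  then show "source s \<subseteq> Pow (space M)" by (rule order_trans[OF source_events sets.space_closed])
qed

lemma history_events: "sets (history t) \<subseteq> events"
  unfolding sets_history by (intro sets.sigma_sets_subset UN_least source_events)

lemma history_mono: "s \<le> t \<Longrightarrow> sets (history s) \<subseteq> sets (history t)"
  unfolding sets_history by (intro sigma_sets_mono' UN_mono past_mono order_refl)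

lemma measurable_history_mono:
  "f \<in> measurable (history s) K \<Longrightarrow> s \<le> t \<Longrightarrow> f \<in> measurable (history t) K"
  by (rule subsetD[OF measurable_mono[OF order_refl refl history_mono]]) simp_all

lemma measurable_historyI:
  assumes "f \<in> space M \<rightarrow> space K" "s \<in> past t"
    "source s = sets (vimage_algebra (space M) f K)"
  shows "f \<in> measurable (history t) K"
proof (rule measurableI)
  fix A assume "A \<in> sets K"
  then have "f -` A \<inter> space M \<in> source s" unfolding assms(3) by (rule in_vimage_algebra)
  then show "f -` A \<inter> space (history t) \<in> sets (history t)"
    unfolding sets_history space_history using assms(2) by (intro sigma_sets.Basic) blast
qed (use assms in auto)

lemma measurable_coin_history: "B t \<in> measurable (history t) (count_space UNIV)"
  by (rule measurable_historyI[of _ _ "Coin t"]) (auto simp: past_def source_def)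

lemma measurable_replacement_history: "\<zeta> (Suc t) \<in> borel_measurable (history (Suc t))"
  by (rule measurable_historyI[of _ _ "Replacement (Suc t)"]) (auto simp: past_def source_def)

abbreviation Y :: "nat \<Rightarrow> 'a \<Rightarrow> real multiset" where
  "Y t \<omega> \<equiv> core p (B t \<omega>) (X t \<omega>)"

lemma measurable_configuration_history:
  assumes "0 < N"
  shows "X t \<in> measurable (history t) (configurations N)"
    and "Y t \<in> measurable (history t) (configurations (N - 1))"
proof -
  have core: "Y t \<in> measurable (history t) (configurations (N - 1))"
    if "X t \<in> measurable (history t) (configurations N)" for t
    using that assms by (intro measurable_core measurable_coin_history) simp
  show X: "X t \<in> measurable (history t) (configurations N)"
  proof (induction t)
    case 0
    show ?case
      by (rule measurable_historyI[of _ _ Initial])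
        (use measurable_space[OF initial_measurable] in \<open>auto simp: past_def source_def\<close>)
  next
    case (Suc t)
    have "(\<lambda>\<omega>. add_mset (\<zeta> (Suc t) \<omega>) (Y t \<omega>)) \<in>
        measurable (history (Suc t)) (configurations (Suc (N - 1)))"
      using measurable_history_mono[OF core[OF Suc], of "Suc t"]
      by (intro measurable_add_mset_configurations measurable_replacement_history) simp
    also have "(\<lambda>\<omega>. add_mset (\<zeta> (Suc t) \<omega>) (Y t \<omega>)) \<in>
        measurable (history (Suc t)) (configurations (Suc (N - 1))) \<longleftrightarrow> ?case"
      unfolding Suc_diff_1[OF assms] by (rule measurable_cong) (simp add: step)
    finally show ?case .
  qed
  show "Y t \<in> measurable (history t) (configurations (N - 1))" by (rule core[OF X])
qed

lemma size_core_process: "0 < N \<Longrightarrow> \<omega> \<in> space M \<Longrightarrow> Suc (size (Y t \<omega>)) = N"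
  using measurable_configuration_size[OF measurable_configuration_history(2)] by simp

lemma history_independent:
  assumes A: "A \<in> sets (history t)" and C: "C \<in> sets borel"
  shows "prob (A \<inter> {\<omega> \<in> space M. \<zeta> (Suc t) \<omega> \<in> C}) = prob A * measure D C"
proof -
  define I where "I = case_bool (past t) {Replacement (Suc t)}"
  define F where "F j = sigma_sets (space M) (\<Union>s\<in>I j. source s)" for j
  have "indep_sets F UNIV"
    unfolding F_def[abs_def]
  proof (rule indep_sets_collect_sigma)
    show "indep_sets source (\<Union>j\<in>UNIV. I j)"
      by (rule indep_sets_mono_index[OF _ source_independent])
        (auto simp: I_def past_def UNIV_bool)
    show "Int_stable (source s)" for s
      by (auto simp: source_def split: randomness.split intro: sets.Int_stable)
    show "disjoint_family_on I UNIV"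
      by (auto simp: disjoint_family_on_def I_def past_def split: bool.splits)
  qed
  define E where "E = {\<omega> \<in> space M. \<zeta> (Suc t) \<omega> \<in> C}"
  have "E = \<zeta> (Suc t) -` C \<inter> space M" by (auto simp: E_def)
  then have "E \<in> source (Replacement (Suc t))"
    using C by (simp add: source_def in_vimage_algebra)
  then have "E \<in> F False" unfolding F_def I_def by (auto intro: sigma_sets.Basic)
  moreover have "A \<in> F True" using A by (simp add: F_def I_def sets_history)
  ultimately have "prob (\<Inter>j\<in>UNIV. case_bool A E j) = (\<Prod>j\<in>UNIV. prob (case_bool A E j))"
    using \<open>indep_sets F UNIV\<close> by (intro indep_setsD) (auto split: bool.split)
  then have "prob (A \<inter> E) = prob A * prob E" by (simp add: UNIV_bool Int_commute mult.commute)
  moreover have "prob E = measure D C"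
    using measure_distr[OF replacement_measurable[of "Suc t"] C] replacement_distr[of "Suc t"]
    by (simp add: E_def vimage_def Int_def conj_commute)
  ultimately show ?thesis by (simp add: E_def)
qed

section \<open>A conditional Borel-Cantelli lemma\<close>

lemma prob_replacement_le_1: "measure D C \<le> 1"
proof -
  have "prob_space D"
    using prob_space_distr[OF replacement_measurable[of 1]] replacement_distr[of 1] by simp
  then show ?thesis by (rule prob_space.prob_le_1)
qed

text \<open>
  Each visit to \<open>A\<close> is followed by a miss of \<open>C\<close> with conditional probability \<open>1 - measure D C\<close>, so
  \<open>m\<close> visits that are all missed cost a factor \<open>(1 - measure D C) ^ m\<close>. Letting the event \<open>F\<close> from
  the history vary replaces conditional expectations and stopping times: the induction on the
  length of the time window splits \<open>F\<close> according to what happens at its first time \<open>t\<close>.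
\<close>

lemma prob_many_misses:
  assumes A: "\<And>t. A t \<in> sets (history t)" and C: "C \<in> sets borel"
    and F: "F \<in> sets (history t)"
  shows "prob (F \<inter> {\<omega> \<in> space M. m \<le> (\<Sum>i\<in>{t..<t + n}. of_bool (\<omega> \<in> A i)) \<and>
      (\<forall>i\<in>{t..<t + n}. \<omega> \<in> A i \<longrightarrow> \<zeta> (Suc i) \<omega> \<notin> C)}) \<le> (1 - measure D C) ^ m * prob F"
    (is "prob (F \<inter> ?W t n m) \<le> _")
  using F
proof (induction n arbitrary: t m F)
  case 0
  then have "F \<in> events" using history_events by blast
  then show ?case using prob_replacement_le_1[of C] by (cases m) (auto simp: sets.Int_space_eq2)
next
  case (Suc n)
  note [measurable] = C
  have [measurable]: "A i \<in> events" for i using A history_events by blast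
  have [measurable]: "random_variable borel (\<zeta> (Suc i))" for i by (rule replacement_measurable) simp
  have F[measurable]: "F \<in> events" using Suc.prems history_events by blast
  have FW: "prob (F \<inter> ?W t (Suc n) m) \<le> prob F" by (intro finite_measure_mono) auto
  let ?\<rho> = "1 - measure D C"
  let ?E = "{\<omega> \<in> space M. \<zeta> (Suc t) \<omega> \<in> C}"
  have E: "?E \<in> sets (history (Suc t))"
    using measurable_sets[OF measurable_replacement_history C] by (simp add: vimage_def Int_def conj_commute)
  have up: "A t \<in> sets (history (Suc t))" "F \<in> sets (history (Suc t))"
    using A Suc.prems history_mono[of t "Suc t"] by auto
  show ?case
  proof (cases m)
    case 0
    then show ?thesis using FW by simp
  next
    case (Suc k)
    have "F \<inter> ?W t (Suc n) m \<subseteq>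
        ((F - A t) \<inter> ?W (Suc t) n m) \<union> ((F \<inter> A t - ?E) \<inter> ?W (Suc t) n k)"
    proof
      fix \<omega> assume "\<omega> \<in> F \<inter> ?W t (Suc n) m"
      then have \<omega>: "\<omega> \<in> F" "\<omega> \<in> space M" "m \<le> (\<Sum>i\<in>{t..<t + Suc n}. of_bool (\<omega> \<in> A i))"
        and miss: "\<forall>i\<in>{t..<t + Suc n}. \<omega> \<in> A i \<longrightarrow> \<zeta> (Suc i) \<omega> \<notin> C"
        by blast+
      have "m \<le> of_bool (\<omega> \<in> A t) + (\<Sum>i\<in>{Suc t..<Suc t + n}. of_bool (\<omega> \<in> A i))"
      proof -
        have "{t..<t + Suc n} = insert t {Suc t..<Suc t + n}" by auto
        then show ?thesis using \<omega>(3) by (simp only:) (subst (asm) sum.insert, auto)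
      qed
      moreover have "\<forall>i\<in>{Suc t..<Suc t + n}. \<omega> \<in> A i \<longrightarrow> \<zeta> (Suc i) \<omega> \<notin> C"
        using miss by simp
      moreover have "\<omega> \<in> A t \<longrightarrow> \<zeta> (Suc t) \<omega> \<notin> C" using miss by simp
      ultimately show "\<omega> \<in> ((F - A t) \<inter> ?W (Suc t) n m) \<union> ((F \<inter> A t - ?E) \<inter> ?W (Suc t) n k)"
        using \<omega>(1,2) Suc by (cases "\<omega> \<in> A t") (simp_all del: sum_of_bool_eq)
    qed
    then have "prob (F \<inter> ?W t (Suc n) m) \<le>
        prob (((F - A t) \<inter> ?W (Suc t) n m) \<union> ((F \<inter> A t - ?E) \<inter> ?W (Suc t) n k))"
      by (rule finite_measure_mono) measurable
    also have "\<dots> \<le> prob ((F - A t) \<inter> ?W (Suc t) n m) + prob ((F \<inter> A t - ?E) \<inter> ?W (Suc t) n k)"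
      by (rule measure_Un_le) measurable
    also have "\<dots> \<le> ?\<rho> ^ m * prob (F - A t) + ?\<rho> ^ k * prob (F \<inter> A t - ?E)"
      using up E by (intro add_mono Suc.IH) auto
    also have "prob (F \<inter> A t - ?E) = ?\<rho> * prob (F \<inter> A t)"
    proof -
      have "F \<inter> A t \<in> sets (history t)" using A Suc.prems by auto
      from history_independent[OF this C]
      have "prob ((F \<inter> A t) \<inter> ?E) = prob (F \<inter> A t) * measure D C" .
      moreover have "prob (F \<inter> A t - ?E) = prob (F \<inter> A t) - prob ((F \<inter> A t) \<inter> ?E)"
        by (rule finite_measure_Diff') measurable
      ultimately show ?thesis by (simp add: algebra_simps)
    qed
    also have "prob (F - A t) = prob F - prob (F \<inter> A t)"
      by (rule finite_measure_Diff') measurable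
    finally show ?thesis by (simp add: Suc algebra_simps)
  qed
qed

text \<open>
  If infinitely many visits occur and all from time \<open>s\<close> on are missed, then for every \<open>m\<close> some
  finite window starting at \<open>s\<close> contains \<open>m\<close> missed visits. The previous bound, valid for all \<open>m\<close>,
  makes this a null event.
\<close>

lemma AE_infinitely_often_hit:
  assumes A: "\<And>t. A t \<in> sets (history t)" and C: "C \<in> sets borel" "0 < measure D C"
  shows "AE \<omega> in M. (\<exists>\<^sub>F t in sequentially. \<omega> \<in> A t) \<longrightarrow>
    (\<exists>\<^sub>F t in sequentially. \<omega> \<in> A t \<and> \<zeta> (Suc t) \<omega> \<in> C)"
proof -
  note [measurable] = C(1)
  have [measurable]: "A i \<in> events" for i using A history_events by blast
  have [measurable]: "random_variable borel (\<zeta> (Suc i))" for i by (rule replacement_measurable) simp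
  have "AE \<omega> in M. \<not> ((\<exists>\<^sub>F t in sequentially. \<omega> \<in> A t) \<and> (\<forall>i\<ge>s. \<omega> \<in> A i \<longrightarrow> \<zeta> (Suc i) \<omega> \<notin> C))"
    for s
  proof -
    let ?Z = "{\<omega> \<in> space M. (\<exists>\<^sub>F t in sequentially. \<omega> \<in> A t) \<and>
      (\<forall>i\<ge>s. \<omega> \<in> A i \<longrightarrow> \<zeta> (Suc i) \<omega> \<notin> C)}"
    have Z[measurable]: "?Z \<in> events" unfolding frequently_sequentially by measurable
    have bound: "prob ?Z \<le> (1 - measure D C) ^ m" for m
    proof -
      define V where "V n = {\<omega> \<in> ?Z. m \<le> (\<Sum>i\<in>{s..<s + n}. of_bool (\<omega> \<in> A i))}" for n
      have V: "V n \<in> events" for n unfolding V_def by measurable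
      have "incseq V"
        unfolding incseq_def
      proof (intro allI impI subsetI)
        fix k n \<omega> assume "k \<le> n" "\<omega> \<in> V k"
        have "(\<Sum>i\<in>{s..<s + k}. of_bool (\<omega> \<in> A i)) \<le> (\<Sum>i\<in>{s..<s + n}. of_bool (\<omega> \<in> A i) :: nat)"
          using \<open>k \<le> n\<close> by (intro sum_mono2) simp_all
        with \<open>\<omega> \<in> V k\<close> show "\<omega> \<in> V n"
          unfolding V_def mem_Collect_eq by (meson order_trans)
      qed
      have "(\<Union>n. V n) = ?Z"
      proof (intro equalityI subsetI)
        fix \<omega> assume \<omega>: "\<omega> \<in> ?Z"
        have "infinite {i. \<omega> \<in> A i \<and> s \<le> i}"
          unfolding infinite_nat_iff_unbounded_le
        proof
          fix k
          obtain i where "max k s \<le> i" "\<omega> \<in> A i"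
            using \<omega> unfolding frequently_sequentially by blast
          then show "\<exists>n\<ge>k. n \<in> {i. \<omega> \<in> A i \<and> s \<le> i}" by auto
        qed
        then obtain J where J: "finite J" "card J = m" "J \<subseteq> {i. \<omega> \<in> A i \<and> s \<le> i}"
          using infinite_arbitrarily_large by blast
        define n where "n = Suc (Max (insert 0 J))"
        have "J \<subseteq> {i \<in> {s..<s + n}. \<omega> \<in> A i}"
        proof
          fix i assume i: "i \<in> J"
          then have "i \<le> Max (insert 0 J)" using J by (intro Max_ge) auto
          then have "i < s + n" unfolding n_def by linarith
          then show "i \<in> {i \<in> {s..<s + n}. \<omega> \<in> A i}" using i J(3) by auto
        qed
        then have "m \<le> card {i \<in> {s..<s + n}. \<omega> \<in> A i}" using J(2) by (auto intro: card_mono)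
        then have "\<omega> \<in> V n" using \<omega> by (simp add: V_def Int_def)
        then show "\<omega> \<in> (\<Union>n. V n)" by blast
      qed (auto simp: V_def)
      moreover have "(\<lambda>n. prob (V n)) \<longlonglongrightarrow> prob (\<Union>n. V n)"
        using V \<open>incseq V\<close> by (intro finite_Lim_measure_incseq) auto
      moreover have "prob (V n) \<le> (1 - measure D C) ^ m" for n
      proof -
        have "prob (V n) \<le> prob (space M \<inter> {\<omega> \<in> space M. m \<le> (\<Sum>i\<in>{s..<s + n}. of_bool (\<omega> \<in> A i)) \<and>
            (\<forall>i\<in>{s..<s + n}. \<omega> \<in> A i \<longrightarrow> \<zeta> (Suc i) \<omega> \<notin> C)})"
          by (rule finite_measure_mono) (auto simp: V_def, measurable)
        also have "\<dots> \<le> (1 - measure D C) ^ m * prob (space M)"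
          using sets.top[of "history s"] by (intro prob_many_misses A C) simp
        finally show ?thesis by (simp add: prob_space)
      qed
      ultimately show ?thesis by (metis LIMSEQ_le_const2)
    qed
    have "(\<lambda>m. (1 - measure D C) ^ m) \<longlonglongrightarrow> 0" 
      using C(2) prob_replacement_le_1[of C] by (intro LIMSEQ_realpow_zero) auto
    then have "prob ?Z \<le> 0" using bound by (intro LIMSEQ_le_const) auto
    then have "prob ?Z = 0" by (simp add: measure_le_0_iff)
    then have "AE \<omega> in M. \<omega> \<notin> ?Z" by (rule prob_eq_0[OF Z, THEN iffD1])
    with AE_space show ?thesis by eventually_elim blast
  qed
  then have "AE \<omega> in M. \<forall>s. \<not> ((\<exists>\<^sub>F t in sequentially. \<omega> \<in> A t) \<and>
      (\<forall>i\<ge>s. \<omega> \<in> A i \<longrightarrow> \<zeta> (Suc i) \<omega> \<notin> C))"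
    unfolding AE_all_countable by (rule allI)
  then show ?thesis
  proof eventually_elim
    case (elim \<omega>)
    then have "\<exists>i\<ge>s. \<omega> \<in> A i \<and> \<zeta> (Suc i) \<omega> \<in> C" if "\<exists>\<^sub>F t in sequentially. \<omega> \<in> A t" for s
      using that by blast
    then show ?case unfolding frequently_sequentially[of "\<lambda>i. \<omega> \<in> A i \<and> \<zeta> (Suc i) \<omega> \<in> C"] by blast
  qed
qed

section \<open>From steering to probability\<close>

definition follows :: "(real \<times> real) list \<Rightarrow> nat \<Rightarrow> 'a \<Rightarrow> bool" where
  "follows I t \<omega> \<longleftrightarrow>
     (\<forall>j<length I. \<zeta> (Suc (t + j)) \<omega> \<in> {fst (I ! j)<..<snd (I ! j)})"

lemma follows_Nil: "follows [] t \<omega>"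
  by (simp add: follows_def)

lemma follows_Cons:
  "follows ((l, u) # I) t \<omega> \<longleftrightarrow> \<zeta> (Suc t) \<omega> \<in> {l<..<u} \<and> follows I (Suc t) \<omega>"
  unfolding follows_def length_Cons All_less_Suc2 by simp

lemma reachable_follows:
  assumes "\<omega> \<in> space M" "follows I t \<omega>"
  shows "Y (t + length I) \<omega> \<in> reachable p I (Y t \<omega>)"
  using assms reachable_trajectory[of "\<lambda>t. Y t \<omega>" p "\<lambda>t. B (Suc t) \<omega>" "\<lambda>t. \<zeta> (Suc t) \<omega>" I t]
  by (simp add: step follows_def)

lemma hit_in_history:
  assumes "A \<in> sets (history t)" "C \<in> sets borel"
  shows "A \<inter> {\<omega> \<in> space M. \<zeta> (Suc t) \<omega> \<in> C} \<in> sets (history (Suc t))"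
proof -
  have "\<zeta> (Suc t) -` C \<inter> space (history (Suc t)) \<in> sets (history (Suc t))"
    by (rule measurable_sets[OF measurable_replacement_history assms(2)])
  moreover have "A \<in> sets (history (Suc t))" using assms(1) history_mono[of t "Suc t"] by auto
  moreover have "\<zeta> (Suc t) -` C \<inter> space (history (Suc t)) = {\<omega> \<in> space M. \<zeta> (Suc t) \<omega> \<in> C}"
    by auto
  ultimately show ?thesis by (metis sets.Int)
qed

text \<open>
  Visits followed by a hit of the first interval are again events of the history, one time unit
  later. The one-step result can therefore be iterated along the list, which avoids treating
  overlapping blocks of several replacement points.
\<close>

lemma AE_infinitely_often_follows:
  assumes A: "\<And>t. A t \<in> sets (history t)"
    and I: "\<forall>(l, u)\<in>set I. 0 \<le> l \<and> l < u \<and> u \<le> 1"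
  shows "AE \<omega> in M. (\<exists>\<^sub>F t in sequentially. \<omega> \<in> A t) \<longrightarrow>
    (\<exists>\<^sub>F t in sequentially. \<omega> \<in> A t \<and> follows I t \<omega>)"
  using A I
proof (induction I arbitrary: A)
  case Nil
  then show ?case by (simp add: follows_Nil)
next
  case (Cons lu I)
  obtain l u where lu: "lu = (l, u)" by (cases lu)
  have lu1: "0 \<le> l" "l < u" "u \<le> 1" using Cons.prems(2) lu by auto
  \<comment> \<open>A' collects the successful visits, dated at the time of the hit; nothing can have been hit by time 0.\<close>
  define A' where "A' t = (case t of 0 \<Rightarrow> {} | Suc s \<Rightarrow>
    A s \<inter> {\<omega> \<in> space M. \<zeta> (Suc s) \<omega> \<in> {l<..<u}})" for t
  have "A' t \<in> sets (history t)" for t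
    using hit_in_history[OF Cons.prems(1), of "{l<..<u}"] by (cases t) (simp_all add: A'_def)
  then have "AE \<omega> in M. (\<exists>\<^sub>F t in sequentially. \<omega> \<in> A' t) \<longrightarrow>
      (\<exists>\<^sub>F t in sequentially. \<omega> \<in> A' t \<and> follows I t \<omega>)"
    using Cons.prems(2) by (intro Cons.IH) auto
  moreover have "AE \<omega> in M. (\<exists>\<^sub>F t in sequentially. \<omega> \<in> A t) \<longrightarrow>
      (\<exists>\<^sub>F t in sequentially. \<omega> \<in> A t \<and> \<zeta> (Suc t) \<omega> \<in> {l<..<u})"
    using full_support[OF lu1] by (intro AE_infinitely_often_hit Cons.prems(1)) auto
  ultimately show ?case
    using AE_space
  proof eventually_elim
    case (elim \<omega>)
    have shift: "(\<exists>\<^sub>F t in sequentially. P (Suc t)) \<longleftrightarrow> (\<exists>\<^sub>F t in sequentially. P t)" for P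
      unfolding frequently_def using eventually_sequentially_Suc[of "\<lambda>t. \<not> P t"] by simp
    have mem: "\<omega> \<in> A' (Suc t) \<longleftrightarrow> \<omega> \<in> A t \<and> \<zeta> (Suc t) \<omega> \<in> {l<..<u}" for t
      using elim(3) by (simp add: A'_def)
    show ?case
    proof
      assume "\<exists>\<^sub>F t in sequentially. \<omega> \<in> A t"
      with elim(2) have "\<exists>\<^sub>F t in sequentially. \<omega> \<in> A' (Suc t)" unfolding mem by (rule mp)
      then have "\<exists>\<^sub>F t in sequentially. \<omega> \<in> A' t" by (rule shift[THEN iffD1])
      with elim(1) have "\<exists>\<^sub>F t in sequentially. \<omega> \<in> A' t \<and> follows I t \<omega>" by (rule mp)
      then have "\<exists>\<^sub>F t in sequentially. \<omega> \<in> A' (Suc t) \<and> follows I (Suc t) \<omega>"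
        by (rule shift[THEN iffD2])
      then show "\<exists>\<^sub>F t in sequentially. \<omega> \<in> A t \<and> follows (lu # I) t \<omega>"
        unfolding mem lu follows_Cons by (simp only: conj_assoc)
    qed
  qed
qed

lemma positive_probability_follows:
  assumes A: "A \<in> sets (history t)" "0 < prob A"
    and I: "\<forall>(l, u)\<in>set I. 0 \<le> l \<and> l < u \<and> u \<le> 1"
  shows "\<exists>E\<in>events. 0 < prob E \<and> (\<forall>\<omega>\<in>E. \<omega> \<in> A \<and> follows I t \<omega>)"
  using A I
proof (induction I arbitrary: A t)
  case Nil
  then show ?case using history_events by (intro bexI[of _ A]) (auto simp: follows_Nil)
next
  case (Cons lu I)
  obtain l u where lu: "lu = (l, u)" by (cases lu)
  have lu1: "0 \<le> l" "l < u" "u \<le> 1" using Cons.prems(3) lu by auto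
  define A' where "A' = A \<inter> {\<omega> \<in> space M. \<zeta> (Suc t) \<omega> \<in> {l<..<u}}"
  have "prob A' = prob A * measure D {l<..<u}"
    unfolding A'_def by (rule history_independent[OF Cons.prems(1)]) simp
  then have "0 < prob A'" using Cons.prems(2) full_support[OF lu1] by simp
  moreover have "A' \<in> sets (history (Suc t))"
    unfolding A'_def by (rule hit_in_history[OF Cons.prems(1)]) simp
  moreover have "\<forall>(l, u)\<in>set I. 0 \<le> l \<and> l < u \<and> u \<le> 1" using Cons.prems(3) by simp
  ultimately obtain E where E: "E \<in> events" "0 < prob E" "\<forall>\<omega>\<in>E. \<omega> \<in> A' \<and> follows I (Suc t) \<omega>"
    using Cons.IH by blast
  then have "\<forall>\<omega>\<in>E. \<omega> \<in> A \<and> follows (lu # I) t \<omega>"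
    unfolding lu follows_Cons A'_def by blast
  with E show ?case by blast
qed

lemma AE_steers_infinitely_often:
  assumes "steers p P Q" and P: "\<And>t. {\<omega> \<in> space M. P (Y t \<omega>)} \<in> sets (history t)"
  shows "AE \<omega> in M. (\<exists>\<^sub>F t in sequentially. P (Y t \<omega>)) \<longrightarrow> (\<exists>t. Q (Y t \<omega>))"
proof -
  obtain I where I: "\<forall>(l, u)\<in>set I. 0 \<le> l \<and> l < u \<and> u \<le> 1"
    and PQ: "\<And>Y. P Y \<Longrightarrow> reachable p I Y \<subseteq> Collect Q"
    using assms(1) unfolding steers_def by blast
  from AE_infinitely_often_follows[OF P I] AE_space show ?thesis
  proof eventually_elim
    case (elim \<omega>)
    show ?case
    proof
      assume "\<exists>\<^sub>F t in sequentially. P (Y t \<omega>)"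
      then have "\<exists>\<^sub>F t in sequentially. P (Y t \<omega>) \<and> follows I t \<omega>"
        using elim by simp
      then obtain t where "P (Y t \<omega>)" "follows I t \<omega>"
        using frequently_ex by blast
      then have "Q (Y (t + length I) \<omega>)"
        using reachable_follows[OF elim(2)] PQ by blast
      then show "\<exists>t. Q (Y t \<omega>)" by blast
    qed
  qed
qed

lemma steers_positive_probability:
  assumes "steers p P Q" and P: "{\<omega> \<in> space M. P (Y t \<omega>)} \<in> sets (history t)"
    and pos: "0 < prob {\<omega> \<in> space M. P (Y t \<omega>)}"
  shows "\<exists>E\<in>events. 0 < prob E \<and> (\<forall>\<omega>\<in>E. \<exists>t. Q (Y t \<omega>))"
proof -
  obtain I where I: "\<forall>(l, u)\<in>set I. 0 \<le> l \<and> l < u \<and> u \<le> 1"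
    and PQ: "\<And>Y. P Y \<Longrightarrow> reachable p I Y \<subseteq> Collect Q"
    using assms(1) unfolding steers_def by blast
  obtain E where E: "E \<in> events" "0 < prob E"
      "\<forall>\<omega>\<in>E. \<omega> \<in> {\<omega> \<in> space M. P (Y t \<omega>)} \<and> follows I t \<omega>"
    using positive_probability_follows[OF P pos I] by blast
  have "\<exists>t. Q (Y t \<omega>)" if "\<omega> \<in> E" for \<omega>
  proof -
    have "\<omega> \<in> space M" "P (Y t \<omega>)" "follows I t \<omega>" using E(3) that by blast+
    then have "Q (Y (t + length I) \<omega>)" using reachable_follows PQ by blast
    then show ?thesis by blast
  qed
  with E(1,2) show ?thesis by blast
qed

section \<open>Limits of the core\<close>

lemma AE_unit: "AE \<omega> in M. \<forall>t. \<zeta> (Suc t) \<omega> \<in> {0..1}"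
proof -
  have "AE \<omega> in M. \<zeta> (Suc t) \<omega> \<in> {0..1}" for t
  proof (rule AE_distrD[where f = "\<zeta> (Suc t)" and M' = borel and P = "\<lambda>x. x \<in> {0..1}"])
    show "random_variable borel (\<zeta> (Suc t))" by (rule replacement_measurable) simp
    show "AE x in distr M borel (\<zeta> (Suc t)). x \<in> {0..1}"
      by (rule ssubst[OF replacement_distr], simp, rule replacement_unit)
  qed
  then show ?thesis unfolding AE_all_countable by (rule allI)
qed

lemma AE_trajectory:
  assumes "p > 1" "N \<ge> 3"
  shows "AE \<omega> in M. trajectory p N (\<lambda>t. Y t \<omega>) (\<lambda>t. \<zeta> (Suc t) \<omega>) (\<lambda>t. B (Suc t) \<omega>)"
  using AE_unit initial_unit AE_space
proof eventually_elim
  case (elim \<omega>)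
  have "set_mset (Y t \<omega>) \<subseteq> {0..1}" for t
  proof (induction t)
    case 0
    show ?case using core_subset elim(2) by (rule order_trans)
  next
    case (Suc t)
    have "set_mset (Y (Suc t) \<omega>) \<subseteq> insert (\<zeta> (Suc t) \<omega>) (set_mset (Y t \<omega>))"
      using core_subset[of p "B (Suc t) \<omega>" "X (Suc t) \<omega>"] step[OF elim(3), of t] by simp
    also have "\<dots> \<subseteq> {0..1}" using Suc elim(1) by blast
    finally show ?case .
  qed
  moreover have "Suc (size (Y t \<omega>)) = N" for t
    using size_core_process[OF _ elim(3)] assms(2) by simp
  ultimately show ?case
    using assms elim(1) step[OF elim(3)] by (intro trajectory.intro) simp_all
qed

lemma AE_replacement_infinitely_often:
  assumes "0 \<le> a" "a < b" "b \<le> 1"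
  shows "AE \<omega> in M. \<exists>\<^sub>F t in sequentially. \<zeta> (Suc t) \<omega> \<in> {a<..<b}"
proof -
  have "space M \<in> sets (history t)" for t using sets.top[of "history t"] by simp
  from AE_infinitely_often_hit[OF this, of "{a<..<b}"] full_support[OF assms] AE_space
  show ?thesis by (auto elim!: AE_mp simp: frequently_sequentially)
qed

end

lemma (in trajectory) order_stat_tendsto:
  assumes "\<And>e. 0 < e \<Longrightarrow> \<forall>\<^sub>F t in sequentially. \<forall>x\<in>#Y t. \<bar>x - a\<bar> < e" "i \<in> {1..N - 1}"
  shows "(\<lambda>t. order_stat i (Y t)) \<longlonglongrightarrow> a"
proof (rule tendstoI)
  fix e :: real assume "0 < e"
  have mem: "order_stat i (Y t) \<in># Y t" for t
    using assms(2) Y_size[of t] by (intro order_stat_in_set) auto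
  show "\<forall>\<^sub>F t in sequentially. dist (order_stat i (Y t)) a < e"
    using assms(1)[OF \<open>0 < e\<close>] mem by (auto elim!: eventually_mono simp: dist_real_def)
qed

context p_contest
begin

text \<open>
  The levels \<open>1 - 1 / (m + 1)\<close> reduce the requirement on the replacement points to countably many
  almost sure events.
\<close>

lemma AE_rises_to_one:
  assumes "p > 1" "N \<ge> 3"
  shows "AE \<omega> in M. (\<exists>t. \<forall>x\<in>#Y t \<omega>. 1 / p \<le> x) \<longrightarrow> core_tendsto N p X B 1 \<omega>"
proof -
  have "AE \<omega> in M. \<exists>\<^sub>F t in sequentially. \<zeta> (Suc t) \<omega> \<in> {1 - inverse (real (Suc m))<..<1}" for m
    by (rule AE_replacement_infinitely_often) (simp_all add: field_simps)
  then have "AE \<omega> in M. \<forall>m. \<exists>\<^sub>F t in sequentially. \<zeta> (Suc t) \<omega> \<in> {1 - inverse (real (Suc m))<..<1}"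
    unfolding AE_all_countable by (rule allI)
  with AE_trajectory[OF assms] show ?thesis
  proof eventually_elim
    case (elim \<omega>)
    interpret trajectory p N "\<lambda>t. Y t \<omega>" "\<lambda>t. \<zeta> (Suc t) \<omega>" "\<lambda>t. B (Suc t) \<omega>" by (rule elim(1))
    show ?case
      unfolding core_tendsto_def
    proof (intro impI ballI order_stat_tendsto)
      fix e :: real assume above: "\<exists>t. \<forall>x\<in>#Y t \<omega>. 1 / p \<le> x" and "0 < e"
      obtain m where m: "inverse (real (Suc m)) < e" using reals_Archimedean[OF \<open>0 < e\<close>] by blast
      obtain T where "\<forall>x\<in>#Y T \<omega>. 1 / p \<le> x" using above by blast
      moreover have "\<exists>\<^sub>F t in sequentially. 1 - inverse (real (Suc m)) \<le> \<zeta> (Suc t) \<omega>"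
        using elim(2)[rule_format, of m] by (rule frequently_elim1) simp
      ultimately have "\<forall>\<^sub>F t in sequentially. \<forall>x\<in>#Y t \<omega>. 1 - inverse (real (Suc m)) \<le> x"
        by (rule above_rises)
      then show "\<forall>\<^sub>F t in sequentially. \<forall>x\<in>#Y t \<omega>. \<bar>x - 1\<bar> < e"
      proof (rule eventually_mono, intro ballI)
        fix t x assume "\<forall>x\<in>#Y t \<omega>. 1 - inverse (real (Suc m)) \<le> x" and x: "x \<in># Y t \<omega>"
        then have "1 - inverse (real (Suc m)) \<le> x" by blast
        moreover have "x \<le> 1" using Y_unit[of t] x by auto
        ultimately show "\<bar>x - 1\<bar> < e" using m by linarith
      qed
    qed
  qed
qed

lemma AE_collapses_to_zero:
  assumes "p > 1" "N \<ge> 3" and K: "1 \<le> K" "K < N" "2 * p * real (N - K - 1) < real N"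
  shows "AE \<omega> in M. (\<forall>\<eta>>0. \<forall>\<^sub>F t in sequentially. tail_count \<eta> (Y t \<omega>) < N - K) \<longrightarrow>
    core_tendsto N p X B 0 \<omega>"
proof -
  have "AE \<omega> in M. \<exists>\<^sub>F t in sequentially. \<zeta> (Suc t) \<omega> \<in> {0<..<inverse (real (Suc m))}" for m
    by (rule AE_replacement_infinitely_often) (simp_all add: field_simps)
  then have "AE \<omega> in M. \<forall>m. \<exists>\<^sub>F t in sequentially. \<zeta> (Suc t) \<omega> \<in> {0<..<inverse (real (Suc m))}"
    unfolding AE_all_countable by (rule allI)
  with AE_trajectory[OF assms(1,2)] show ?thesis
  proof eventually_elim
    case (elim \<omega>)
    interpret trajectory p N "\<lambda>t. Y t \<omega>" "\<lambda>t. \<zeta> (Suc t) \<omega>" "\<lambda>t. B (Suc t) \<omega>" by (rule elim(1))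
    show ?case
      unfolding core_tendsto_def
    proof (intro impI ballI order_stat_tendsto)
      fix e :: real
      assume few: "\<forall>\<eta>>0. \<forall>\<^sub>F t in sequentially. tail_count \<eta> (Y t \<omega>) < N - K" and "0 < e"
      obtain m where m: "inverse (real (Suc m)) < e" using reals_Archimedean[OF \<open>0 < e\<close>] by blast
      have "\<exists>\<^sub>F t in sequentially. \<zeta> (Suc t) \<omega> < e"
        using elim(2)[rule_format, of m] by (rule frequently_elim1) (use m in simp)
      then have "\<forall>\<^sub>F t in sequentially. \<forall>x\<in>#Y t \<omega>. x < e"
        using few \<open>0 < e\<close> by (intro collapses[OF K]) simp_all
      then show "\<forall>\<^sub>F t in sequentially. \<forall>x\<in>#Y t \<omega>. \<bar>x - 0\<bar> < e"
      proof (rule eventually_mono, intro ballI)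
        fix t x assume "\<forall>x\<in>#Y t \<omega>. x < e" and x: "x \<in># Y t \<omega>"
        then have "x < e" by blast
        moreover have "0 \<le> x" using Y_unit[of t] x by auto
        ultimately show "\<bar>x - 0\<bar> < e" by simp
      qed
    qed
  qed
qed

lemma core_tendsto_events: "{\<omega> \<in> space M. core_tendsto N p X B a \<omega>} \<in> events"
proof (cases "0 < N")
  case True
  have [measurable]: "(\<lambda>\<omega>. order_stat i (Y t \<omega>)) \<in> borel_measurable M" if "i \<in> {1..N - 1}" for i t
  proof -
    have "(\<lambda>\<omega>. order_stat i (Y t \<omega>)) \<in> borel_measurable (history t)"
      using measurable_order_stat[OF measurable_configuration_history(2)[OF True] that] .
    then show ?thesis
      by (rule subsetD[OF measurable_mono[OF order_refl refl history_events space_history]])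
  qed
  show ?thesis unfolding core_tendsto_def by measurable
qed (simp add: core_tendsto_def)

lemma tail_count_events:
  assumes "0 < N"
  shows "{\<omega> \<in> space M. k \<le> tail_count e (Y t \<omega>)} \<in> sets (history t)"
proof -
  note [measurable] = measurable_tail_count[OF measurable_configuration_history(2)[OF assms]]
  have "{\<omega> \<in> space (history t). k \<le> tail_count e (Y t \<omega>)} \<in> sets (history t)" by measurable
  then show ?thesis by simp
qed

text \<open>
  The starting condition of \<open>steers_escape\<close>: \<open>N - k\<close> core points above \<open>e\<close> means that the \<open>k\<close>-th of
  the \<open>N - 1\<close> order statistics is at least \<open>e\<close>.
\<close>

definition escaping :: "nat \<Rightarrow> real \<Rightarrow> real multiset \<Rightarrow> bool" where
  "escaping k e S \<longleftrightarrow> Suc (size S) = N \<and> (\<forall>x\<in>#S. 0 \<le> x) \<and> N - k \<le> tail_count e S"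

lemma escaping_events:
  assumes "0 < N"
  shows "{\<omega> \<in> space M. escaping k e (Y t \<omega>)} \<in> sets (history t)"
proof -
  have "escaping k e (Y t \<omega>) \<longleftrightarrow>
      N - 1 \<le> tail_count 0 (Y t \<omega>) \<and> N - k \<le> tail_count e (Y t \<omega>)" if "\<omega> \<in> space M" for \<omega>
    using size_core_process[OF assms that, of t] tail_count_le_size[of 0 "Y t \<omega>"]
      tail_count_eq_size_iff[of 0 "Y t \<omega>"]
    unfolding escaping_def by linarith
  then have "{\<omega> \<in> space M. escaping k e (Y t \<omega>)} =
      {\<omega> \<in> space M. N - 1 \<le> tail_count 0 (Y t \<omega>)} \<inter> {\<omega> \<in> space M. N - k \<le> tail_count e (Y t \<omega>)}"
    by blast
  then show ?thesis using tail_count_events[OF assms] by (simp only: sets.Int)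
qed

text \<open>
  If at every level \<open>1 / (m + 1)\<close> escaping configurations stop occurring, the \<open>K\<close>-th order
  statistic tends to \<open>0\<close>, which forces a collapse; otherwise some level is visited infinitely often
  and almost surely one visit leads above \<open>1 / p\<close>.
\<close>

lemma AE_converges:
  assumes "p > 1" "N \<ge> 3"
  shows "AE \<omega> in M. core_tendsto N p X B 0 \<omega> \<or> core_tendsto N p X B 1 \<omega>"
proof -
  have N: "0 < N" "2 \<le> N" using assms(2) by auto
  obtain K where K: "1 \<le> K" "K < N" "real N < 2 * p * real (N - K + 1)"
    "2 * p * real (N - K - 1) < real N"
    using critical_rank_exists[OF assms(1) N(2)] .
  have "AE \<omega> in M. (\<exists>\<^sub>F t in sequentially. escaping K (inverse (real (Suc m))) (Y t \<omega>)) \<longrightarrow>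
      (\<exists>t. Suc (size (Y t \<omega>)) = N \<and> (\<forall>x\<in>#Y t \<omega>. 1 / p \<le> x))" for m
    by (rule AE_steers_infinitely_often[OF _ escaping_events[OF N(1)]])
      (use steers_escape[OF assms(1) K(1,2,3), of "inverse (real (Suc m))"]
        in \<open>simp add: escaping_def[abs_def]\<close>)
  then have "AE \<omega> in M. \<forall>m. (\<exists>\<^sub>F t in sequentially. escaping K (inverse (real (Suc m))) (Y t \<omega>)) \<longrightarrow>
      (\<exists>t. Suc (size (Y t \<omega>)) = N \<and> (\<forall>x\<in>#Y t \<omega>. 1 / p \<le> x))"
    unfolding AE_all_countable by (rule allI)
  with AE_rises_to_one[OF assms] AE_collapses_to_zero[OF assms K(1,2,4)] AE_trajectory[OF assms]
  show ?thesis
  proof eventually_elim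
    case (elim \<omega>)
    interpret trajectory p N "\<lambda>t. Y t \<omega>" "\<lambda>t. \<zeta> (Suc t) \<omega>" "\<lambda>t. B (Suc t) \<omega>" by (rule elim(3))
    show ?case
    proof (cases "\<exists>m. \<exists>\<^sub>F t in sequentially. escaping K (inverse (real (Suc m))) (Y t \<omega>)")
      case True
      then have "\<exists>t. \<forall>x\<in>#Y t \<omega>. 1 / p \<le> x" using elim(4) by blast
      then show ?thesis using elim(1) by blast
    next
      case False
      have "\<forall>\<^sub>F t in sequentially. tail_count \<eta> (Y t \<omega>) < N - K" if "0 < \<eta>" for \<eta>
      proof -
        obtain m where m: "inverse (real (Suc m)) < \<eta>"
          using reals_Archimedean[OF \<open>0 < \<eta>\<close>] by blast
        have "\<forall>\<^sub>F t in sequentially. \<not> escaping K (inverse (real (Suc m))) (Y t \<omega>)"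
          using False by (simp add: frequently_def)
        then show ?thesis
        proof eventually_elim
          case (elim t)
          have "\<forall>x\<in>#Y t \<omega>. 0 \<le> x" using Y_unit[of t] by auto
          then have "\<not> N - K \<le> tail_count (inverse (real (Suc m))) (Y t \<omega>)"
            using elim Y_size[of t] unfolding escaping_def by blast
          then show ?case
            using tail_count_antimono[OF less_imp_le[OF m], of "Y t \<omega>"] by linarith
        qed
      qed
      then show ?thesis using elim(2) by blast
    qed
  qed
qed

text \<open>
  Up to a null event, positivity of the \<open>k\<close>-th order statistic is the union over \<open>m\<close> of the escaping
  conditions at level \<open>1 / (m + 1)\<close>; one of these countably many events must have positive probability.
\<close>

lemma positive_probability_one:
  assumes "p > 1" "N \<ge> 3" and k: "1 \<le> k" "k < N" "real N < 2 * p * real (N - k + 1)"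
    and positive: "AE \<omega> in M. 0 < order_stat k (Y 0 \<omega>)"
  shows "0 < prob {\<omega> \<in> space M. core_tendsto N p X B 1 \<omega>}"
proof -
  have N: "0 < N" using assms(2) by auto
  let ?E = "\<lambda>m. {\<omega> \<in> space M. escaping k (inverse (real (Suc m))) (Y 0 \<omega>)}"
  have events: "?E m \<in> events" for m using escaping_events[OF N] history_events by blast
  have "AE \<omega> in M. \<exists>m. \<omega> \<in> ?E m"
    using positive AE_trajectory[OF assms(1,2)] AE_space
  proof eventually_elim
    case (elim \<omega>)
    interpret trajectory p N "\<lambda>t. Y t \<omega>" "\<lambda>t. \<zeta> (Suc t) \<omega>" "\<lambda>t. B (Suc t) \<omega>" by (rule elim(2))
    obtain m where m: "inverse (real (Suc m)) < order_stat k (Y 0 \<omega>)"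
      using reals_Archimedean[OF elim(1)] by blast
    have "k \<in> {1..size (Y 0 \<omega>)}" using k Y_size[of 0] by auto
    then have "size (Y 0 \<omega>) < tail_count (inverse (real (Suc m))) (Y 0 \<omega>) + k"
      using le_order_stat_iff less_imp_le[OF m] by blast
    then have "escaping k (inverse (real (Suc m))) (Y 0 \<omega>)"
      using Y_size[of 0] Y_unit[of 0] unfolding escaping_def by auto
    then show ?case using elim(3) by blast
  qed
  have "\<exists>m. 0 < prob (?E m)"
  proof (rule ccontr)
    assume "\<not> ?thesis"
    then have "\<not> 0 < prob (?E m)" for m by blast
    then have "prob (?E m) = 0" for m
      using measure_nonneg[of M "?E m"] by (simp only: zero_less_measure_iff not_not)
    then have "AE \<omega> in M. \<omega> \<notin> ?E m" for m
      using prob_eq_0[OF events] by simp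
    then have "AE \<omega> in M. \<forall>m. \<omega> \<notin> ?E m" unfolding AE_all_countable by (rule allI)
    with \<open>AE \<omega> in M. \<exists>m. \<omega> \<in> ?E m\<close> have "AE \<omega> in M. False" by eventually_elim blast
    then show False by simp
  qed
  then obtain m where m: "0 < prob (?E m)" by blast
  have "steers p (escaping k (inverse (real (Suc m)))) (\<lambda>Y. Suc (size Y) = N \<and> (\<forall>x\<in>#Y. 1 / p \<le> x))"
    using steers_escape[OF assms(1) k, of "inverse (real (Suc m))"] by (simp add: escaping_def[abs_def])
  from steers_positive_probability[OF this escaping_events[OF N] m]
  obtain E where E: "E \<in> events" "0 < prob E" "\<forall>\<omega>\<in>E. \<exists>t. \<forall>x\<in>#Y t \<omega>. 1 / p \<le> x" by blast
  have "AE \<omega> in M. \<omega> \<in> E \<longrightarrow> \<omega> \<in> {\<omega> \<in> space M. core_tendsto N p X B 1 \<omega>}"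
    using AE_rises_to_one[OF assms(1,2)] AE_space
  proof eventually_elim
    case (elim \<omega>)
    then show ?case using E(3) by blast
  qed
  then have "prob E \<le> prob {\<omega> \<in> space M. core_tendsto N p X B 1 \<omega>}"
    using core_tendsto_events by (rule finite_measure_mono_AE)
  with E(2) show ?thesis by linarith
qed

lemma AE_one_if_above:
  assumes "p > 1" "N \<ge> 3" and above: "AE \<omega> in M. 1 / p \<le> order_stat 1 (Y 0 \<omega>)"
  shows "AE \<omega> in M. core_tendsto N p X B 1 \<omega>"
  using AE_rises_to_one[OF assms(1,2)] above AE_space
proof eventually_elim
  case (elim \<omega>)
  have size: "Suc (size (Y 0 \<omega>)) = N" using size_core_process[OF _ elim(3)] assms(2) by simp
  then have "1 \<in> {1..size (Y 0 \<omega>)}" using assms(2) by simp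
  then have "size (Y 0 \<omega>) < tail_count (1 / p) (Y 0 \<omega>) + 1"
    using elim(2) le_order_stat_iff by blast
  then have "tail_count (1 / p) (Y 0 \<omega>) = size (Y 0 \<omega>)"
    using tail_count_le_size[of "1 / p" "Y 0 \<omega>"] by linarith
  then have "\<forall>x\<in>#Y 0 \<omega>. 1 / p \<le> x" by (simp only: tail_count_eq_size_iff)
  then show ?case using elim(1) by blast
qed

end

theorem theorem2:
  fixes M :: "'a measure" and N :: nat and p :: real and D :: "real measure"
    and X :: "nat \<Rightarrow> 'a \<Rightarrow> real multiset" and \<zeta> :: "nat \<Rightarrow> 'a \<Rightarrow> real" and B :: "nat \<Rightarrow> 'a \<Rightarrow> bool"
  assumes "N \<ge> 3" and "p > 1" and "p_contest M N p D X \<zeta> B"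
  shows
    "measure M ({\<omega> \<in> space M. core_tendsto N p X B 0 \<omega>} \<union>
                {\<omega> \<in> space M. core_tendsto N p X B 1 \<omega>}) = 1 \<and>
     ((AE \<omega> in M. order_stat 1 (core p (B 0 \<omega>) (X 0 \<omega>)) \<ge> 1 / p) \<longrightarrow>
        measure M {\<omega> \<in> space M. core_tendsto N p X B 1 \<omega>} = 1) \<and>
     (\<forall>k\<in>{1..N - 1}.
        2 * p * (real N - real k) > real N - 2 * p \<longrightarrow>
        (AE \<omega> in M. order_stat k (core p (B 0 \<omega>) (X 0 \<omega>)) > 0) \<longrightarrow>
        measure M {\<omega> \<in> space M. core_tendsto N p X B 1 \<omega>} > 0)"
proof -
  interpret p_contest M N p D X \<zeta> B by (rule assms(3))
  let ?Z = "\<lambda>a. {\<omega> \<in> space M. core_tendsto N p X B a \<omega>}"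
  have "prob (?Z 0 \<union> ?Z 1) = 1"
    using AE_converges[OF assms(2,1)] AE_space core_tendsto_events
    by (subst prob_eq_1) (auto elim!: AE_mp)
  moreover have "prob (?Z 1) = 1" if "AE \<omega> in M. order_stat 1 (core p (B 0 \<omega>) (X 0 \<omega>)) \<ge> 1 / p"
    using AE_one_if_above[OF assms(2,1) that] AE_space core_tendsto_events
    by (subst prob_eq_1) (auto elim!: AE_mp)
  moreover have "0 < prob (?Z 1)"
    if "k \<in> {1..N - 1}" "2 * p * (real N - real k) > real N - 2 * p"
      "AE \<omega> in M. order_stat k (core p (B 0 \<omega>) (X 0 \<omega>)) > 0" for k
  proof (rule positive_probability_one[OF assms(2,1) _ _ _ that(3)])
    show "1 \<le> k" "k < N" using that(1) assms(1) by auto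
    then show "real N < 2 * p * real (N - k + 1)"
      using that(2) by (simp add: of_nat_diff algebra_simps)
  qed
  ultimately show ?thesis by blast
qed

end
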